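(* Assume the setting below and that $K$ is a $\kappa$-AEC. Let $\lambda>\mathrm{LS}(K)$ and let $\langle M_i:i<\delta\rangle$ be a $\le_K$-increasing chain of models (each $M_i\le_K\mathcal N$) such that each $M_i$ is $\lambda$-saturated for types of length one. If $\mathrm{cf}(\delta)\ge\overline\kappa_1(\mathop{\smile\!\!\!\!\mid})$ and $\chi^{<\kappa_r}<\lambda$ for all $\chi<\lambda$, then $\bigcup_{i<\delta}|M_i|$ is $\lambda$-saturated for types of length one.
   Context: Setting: $\kappa,\lambda_0$ are infinite cardinals; $\kappa_r$ is the least regular cardinal $\ge\kappa$. $K$ is a coherent abstract class (a class of structures closed under isomorphism with a partial order $\le_K$ refining substructure, invariant under isomorphism, such that $M_0\subseteq M_1\le_K M_2$ and $M_0\le_K M_2$ imply $M_0\le_K M_1$), all of whose models have size $\ge\lambda_0$. Fix $\mathcal N\in K$; "model" means some $M\in K$ with $M\le_K\mathcal N$, all sets are subsets of $|\mathcal N|$, and Galois types $\mathrm{gtp}(\bar a/A;\mathcal N)$ are computed in $\mathcal N$ (no homogeneity assumed). For a model $M$ and $A,B\subseteq|\mathcal N|$ there is a relation $A\mathop{\smile\!\!\!\!\mid}_M B$ satisfying: invariance under automorphisms; monotonicity ($A_0\subseteq A$, $B_0\subseteq B$); normality ($A\mathop{\smile\!\!\!\!\mid}_M B\Rightarrow A\cup|M|\mathop{\smile\!\!\!\!\mid}_M B\cup|M|$); base monotonicity ($A\mathop{\smile\!\!\!\!\mid}_M B$, $M\le_K M'$ model, $|M'|\subseteq B\cup|M|$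 $\Rightarrow A\mathop{\smile\!\!\!\!\mid}_{M'}B$); symmetry ($A\mathop{\smile\!\!\!\!\mid}_M B\Rightarrow B\mathop{\smile\!\!\!\!\mid}_M A$); strong transitivity (for any models $M_0,M_1$, not necessarily $M_0\le_K M_1$: $A\mathop{\smile\!\!\!\!\mid}_{M_0}|M_1|$ and $A\mathop{\smile\!\!\!\!\mid}_{M_1}B$ imply $A\mathop{\smile\!\!\!\!\mid}_{M_0}B$); uniqueness for unions of models for types of length $\le 1$ (if $M_0\le_K M$ are models, $B=\bigcup_{i<\gamma}|M'_i|$ for a $\le_K$-increasing chain of models with $|M_0|\subseteq B\subseteq|M|$, and $a,b$ are elements or empty tuples with $\mathrm{gtp}(a/M_0;\mathcal N)=\mathrm{gtp}(b/M_0;\mathcal N)$, $a\mathop{\smile\!\!\!\!\mid}_{M_0}B$, $b\mathop{\smile\!\!\!\!\mid}_{M_0}B$, then $\mathrm{gtp}(a/B;\mathcal N)=\mathrm{gtp}(b/B;\mathcal N)$); and for every cardinal $\alpha$, $\kappa_\alpha(\mathop{\smile\!\!\!\!\mid})\le((\alpha+\lambda_0)^{<\kappa_r})^+$. Here $\kappa_\alpha(\mathop{\smile\!\!\!\!\mid})$ is the least $\mu\ge\alpha^++\lambda_0^+$ such that for every model $M$ and $A$ with $|A|\le\alpha$ there is a model $M_0\le_K M$ with $\|M_0\|<\mu$ and $A\mathop{\smile\!\!\!\!\mid}_{M_0}|M|$; and $\overline\kappa_\alpha(\mathop{\smile\!\!\!\!\mid})$ is the least $\mu\ge\alpha^++\aleph_0$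 such that for every regular $\delta\ge\mu$, every $\le_K$-increasing chain of models $\langle M_i:i<\delta\rangle$ and every $A$ with $|A|\le\alpha$, there is $i<\delta$ with $A\mathop{\smile\!\!\!\!\mid}_{M_i}\bigcup_{j<\delta}|M_j|$. A set $X\subseteq|\mathcal N|$ is $\lambda$-saturated for types of length one if for every $A\subseteq X$ with $|A|<\lambda$ and every $c\in|\mathcal N|$, $\mathrm{gtp}(c/A;\mathcal N)$ is realized by an element of $X$. A $\kappa$-AEC is a coherent abstract class in a $(<\kappa)$-ary language closed under unions of $\le_K$-chains of cofinality $\ge\kappa$ (the union extending each member and being $\le_K$ any common upper bound) and with a Löwenheim–Skolem number $\mathrm{LS}(K)$: every $A\subseteq|M|$ lies in some $M_0\le_K M$ with $\|M_0\|\le|A|^{<\kappa}+\mathrm{LS}(K)$. *)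

theory Defs
  imports Main "HOL-Library.FuncSet"
begin

unbundle cardinal_syntax

section \<open>Cardinals\<close>

text \<open>
  Cardinals are represented, as in the library, by relations satisfying \<^const>\<open>card_order_on\<close> on
  their field and are compared by \<open>\<le>o\<close>, \<open><o\<close>.
\<close>

definition least_card :: "('a rel \<Rightarrow> bool) \<Rightarrow> 'a rel \<Rightarrow> bool" where
  "least_card P \<mu> \<longleftrightarrow>
     Card_order \<mu> \<and> P \<mu> \<and> (\<forall>\<nu>. Card_order \<nu> \<and> P \<nu> \<longrightarrow> \<mu> \<le>o \<nu>)"

text \<open>
  \<open>\<chi>\<^sup><\<^sup>\<kappa>\<close> is the supremum of \<open>\<chi>\<^sup>\<beta>\<close> over the cardinals \<open>\<beta> < \<kappa>\<close>.  All these powers live on the type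
  \<open>'b \<Rightarrow> 'a\<close>, so they are bounded by the cardinality of that type and the supremum exists there.
\<close>

definition cexp_less :: "'a rel \<Rightarrow> 'b rel \<Rightarrow> ('b \<Rightarrow> 'a) rel" where
  "cexp_less \<chi> \<kappa> =
     (SOME \<mu>. least_card (\<lambda>\<nu>. \<forall>\<beta> :: 'b rel. Card_order \<beta> \<and> \<beta> <o \<kappa> \<longrightarrow> \<chi> ^c \<beta> \<le>o \<nu>) \<mu>)"

text \<open>
  The least regular cardinal \<open>\<ge> \<kappa>\<close>.  It is \<open>\<kappa>\<close> or \<open>\<kappa>\<^sup>+\<close>, hence exists on the type of \<^term>\<open>cardSuc \<kappa>\<close>.
\<close>

definition regular_above :: "'a rel \<Rightarrow> 'a set rel" where
  "regular_above \<kappa> = (SOME \<mu>. least_card (\<lambda>\<nu>. cinfinite \<nu> \<and> regularCard \<nu> \<and> \<kappa> \<le>o \<nu>) \<mu>)"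

text \<open>
  Cofinality of a well-order.  The library's \<^const>\<open>cofinal\<close> asks for strictly larger elements and
  would make every set fail to be cofinal in a successor ordinal; here successors have cofinality 1.
\<close>

definition unbounded_in :: "'a set \<Rightarrow> 'a rel \<Rightarrow> bool" where
  "unbounded_in A r \<longleftrightarrow> A \<subseteq> Field r \<and> (\<forall>a \<in> Field r. \<exists>b \<in> A. (a, b) \<in> r)"

definition cofinality :: "'a rel \<Rightarrow> 'a rel" where
  "cofinality r =
     (SOME \<mu>. (\<exists>A. unbounded_in A r \<and> \<mu> = |A| ) \<and> (\<forall>A. unbounded_in A r \<longrightarrow> \<mu> \<le>o |A| ))"


section \<open>Structures in an infinitary language\<close>

text \<open>
  The arity of a symbol is a set of positions (of type \<open>'p\<close>); a tuple of that arity from a set \<open>U\<close> is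
  an element of \<^term>\<open>PiE ar (\<lambda>_. U)\<close>.
\<close>

record ('f, 'r, 'p) lang =
  funs :: "'f set"
  rels :: "'r set"
  far :: "'f \<Rightarrow> 'p set"
  rar :: "'r \<Rightarrow> 'p set"

record ('f, 'r, 'p, 'u) struct =
  carr :: "'u set"
  fn_of :: "'f \<Rightarrow> ('p \<Rightarrow> 'u) \<Rightarrow> 'u"
  rel_of :: "'r \<Rightarrow> ('p \<Rightarrow> 'u) set"

abbreviation tuples :: "'p set \<Rightarrow> 'u set \<Rightarrow> ('p \<Rightarrow> 'u) set" where
  "tuples ar U \<equiv> PiE ar (\<lambda>_. U)"

text \<open>
  The values outside the carrier and outside the language are normalised, so that equality of
  records is equality of structures.
\<close>

definition is_struct :: "('f, 'r, 'p) lang \<Rightarrow> ('f, 'r, 'p, 'u) struct \<Rightarrow> bool" where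
  "is_struct L M \<longleftrightarrow>
     (\<forall>g \<in> funs L. fn_of M g \<in> PiE (tuples (far L g) (carr M)) (\<lambda>_. carr M)) \<and>
     (\<forall>g. g \<notin> funs L \<longrightarrow> fn_of M g = (\<lambda>_. undefined)) \<and>
     (\<forall>s \<in> rels L. rel_of M s \<subseteq> tuples (rar L s) (carr M)) \<and>
     (\<forall>s. s \<notin> rels L \<longrightarrow> rel_of M s = {})"

definition substruct ::
  "('f, 'r, 'p) lang \<Rightarrow> ('f, 'r, 'p, 'u) struct \<Rightarrow> ('f, 'r, 'p, 'u) struct \<Rightarrow> bool" where
  "substruct L M M' \<longleftrightarrow>
     is_struct L M \<and> is_struct L M' \<and> carr M \<subseteq> carr M' \<and>
     (\<forall>g \<in> funs L. \<forall>x \<in> tuples (far L g) (carr M). fn_of M g x = fn_of M' g x) \<and>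
     (\<forall>s \<in> rels L. rel_of M s = rel_of M' s \<inter> tuples (rar L s) (carr M))"

definition iso ::
  "('f, 'r, 'p) lang \<Rightarrow> ('u \<Rightarrow> 'u) \<Rightarrow> ('f, 'r, 'p, 'u) struct \<Rightarrow> ('f, 'r, 'p, 'u) struct \<Rightarrow> bool" where
  "iso L f M M' \<longleftrightarrow>
     is_struct L M \<and> is_struct L M' \<and> bij_betw f (carr M) (carr M') \<and>
     (\<forall>g \<in> funs L. \<forall>x \<in> tuples (far L g) (carr M).
        f (fn_of M g x) = fn_of M' g (restrict (f \<circ> x) (far L g))) \<and>
     (\<forall>s \<in> rels L. \<forall>x \<in> tuples (rar L s) (carr M).
        x \<in> rel_of M s \<longleftrightarrow> restrict (f \<circ> x) (rar L s) \<in> rel_of M' s)"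


section \<open>Coherent abstract classes\<close>

text \<open>
  The type \<open>'u\<close> plays the role of the universe of sets from which carriers are taken; it is
  arbitrary, in particular it may be much larger than any given structure.
\<close>

locale coherent_abstract_class =
  fixes L :: "('f, 'r, 'p) lang"
    and K :: "('f, 'r, 'p, 'u) struct set"
    and leK :: "('f, 'r, 'p, 'u) struct \<Rightarrow> ('f, 'r, 'p, 'u) struct \<Rightarrow> bool"
  assumes structures: "M \<in> K \<Longrightarrow> is_struct L M"
    and iso_closed: "M \<in> K \<Longrightarrow> iso L f M M' \<Longrightarrow> M' \<in> K"
    and le_in_class: "leK M M' \<Longrightarrow> M \<in> K \<and> M' \<in> K"
    and le_refl: "M \<in> K \<Longrightarrow> leK M M"
    and le_trans: "leK M0 M1 \<Longrightarrow> leK M1 M2 \<Longrightarrow> leK M0 M2"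
    and le_antisym: "leK M M' \<Longrightarrow> leK M' M \<Longrightarrow> M = M'"
    and le_substruct: "leK M M' \<Longrightarrow> substruct L M M'"
    and le_iso: "leK M N \<Longrightarrow> iso L f N N' \<Longrightarrow> iso L f M M' \<Longrightarrow> leK M' N'"
    and coherence: "substruct L M0 M1 \<Longrightarrow> leK M1 M2 \<Longrightarrow> leK M0 M2 \<Longrightarrow> leK M0 M1"

definition is_chain ::
  "('f, 'r, 'p, 'u) struct set \<Rightarrow> (('f, 'r, 'p, 'u) struct \<Rightarrow> ('f, 'r, 'p, 'u) struct \<Rightarrow> bool) \<Rightarrow>
   'd rel \<Rightarrow> ('d \<Rightarrow> ('f, 'r, 'p, 'u) struct) \<Rightarrow> bool" where
  "is_chain C leK r M \<longleftrightarrow>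
     Well_order r \<and> (\<forall>i \<in> Field r. M i \<in> C) \<and> (\<forall>i j. (i, j) \<in> r \<longrightarrow> leK (M i) (M j))"

abbreviation chain_union :: "'d rel \<Rightarrow> ('d \<Rightarrow> ('f, 'r, 'p, 'u) struct) \<Rightarrow> 'u set" where
  "chain_union r M \<equiv> (\<Union>i \<in> Field r. carr (M i))"

text \<open>
  \<open>\<kappa>\<close>-AECs.  In \<open>chains\<close>, the structure \<open>U\<close> is the union of the chain: its carrier is the union of
  the carriers, each member is a substructure of it, and since arities are smaller than the
  cofinality this determines all of its functions and relations.  Chains are indexed by well-orders on
  subsets of \<open>'u set\<close>; a chain of subsets of \<open>'u\<close> has at most \<open>|'u|\<close> distinct members, so longer
  index sets give nothing new.  In \<open>lowenheim_skolem\<close>, \<open>ls\<close> is any cardinal with the defining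
  property of \<open>LS(K)\<close>.
\<close>

locale kappa_AEC = coherent_abstract_class L K leK
  for L :: "('f, 'r, 'p) lang"
    and K :: "('f, 'r, 'p, 'u) struct set"
    and leK :: "('f, 'r, 'p, 'u) struct \<Rightarrow> ('f, 'r, 'p, 'u) struct \<Rightarrow> bool" +
  fixes \<kappa> :: "'k rel"
    and ls :: "'l rel"
  assumes kappa_infinite: "Cinfinite \<kappa>"
    and fun_arity: "g \<in> funs L \<Longrightarrow> |far L g| <o \<kappa>"
    and rel_arity: "s \<in> rels L \<Longrightarrow> |rar L s| <o \<kappa>"
    and chains: "\<And>(r :: 'u set rel) M. is_chain K leK r M \<Longrightarrow> \<kappa> \<le>o cofinality r \<Longrightarrow>
        \<exists>U \<in> K. carr U = chain_union r M \<and> (\<forall>i \<in> Field r. leK (M i) U) \<and>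
          (\<forall>M'. (\<forall>i \<in> Field r. leK (M i) M') \<longrightarrow> leK U M')"
    and ls_card: "Card_order ls"
    and lowenheim_skolem: "M \<in> K \<Longrightarrow> A \<subseteq> carr M \<Longrightarrow>
        \<exists>M0. leK M0 M \<and> A \<subseteq> carr M0 \<and> |carr M0| \<le>o cexp_less |A| \<kappa> +c ls"


section \<open>Galois types\<close>

definition K_embedding ::
  "('f, 'r, 'p) lang \<Rightarrow> (('f, 'r, 'p, 'u) struct \<Rightarrow> ('f, 'r, 'p, 'u) struct \<Rightarrow> bool) \<Rightarrow>
   ('u \<Rightarrow> 'u) \<Rightarrow> ('f, 'r, 'p, 'u) struct \<Rightarrow> ('f, 'r, 'p, 'u) struct \<Rightarrow> bool" where
  "K_embedding L leK f M N \<longleftrightarrow> (\<exists>M'. leK M' N \<and> iso L f M M')"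

text \<open>
  Atomic equivalence of triples \<open>(b, A, N)\<close>: amalgamation over \<open>A\<close> identifying the two tuples.  As it
  need not be transitive, the Galois type is the class of the triple under the generated
  equivalence relation.  Tuples are finite lists; only tuples of length at most one are used below.
\<close>

definition E_at ::
  "('f, 'r, 'p) lang \<Rightarrow> ('f, 'r, 'p, 'u) struct set \<Rightarrow>
   (('f, 'r, 'p, 'u) struct \<Rightarrow> ('f, 'r, 'p, 'u) struct \<Rightarrow> bool) \<Rightarrow>
   'u list \<times> 'u set \<times> ('f, 'r, 'p, 'u) struct \<Rightarrow>
   'u list \<times> 'u set \<times> ('f, 'r, 'p, 'u) struct \<Rightarrow> bool" where
  "E_at L K leK = (\<lambda>(b1, A1, N1) (b2, A2, N2).
     N1 \<in> K \<and> A1 \<subseteq> carr N1 \<and> set b1 \<subseteq> carr N1 \<and>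
     N2 \<in> K \<and> A2 \<subseteq> carr N2 \<and> set b2 \<subseteq> carr N2 \<and> A1 = A2 \<and>
     (\<exists>N f1 f2. K_embedding L leK f1 N1 N \<and> K_embedding L leK f2 N2 N \<and>
        (\<forall>a \<in> A1. f1 a = a \<and> f2 a = a) \<and> map f1 b1 = map f2 b2))"

definition gtp ::
  "('f, 'r, 'p) lang \<Rightarrow> ('f, 'r, 'p, 'u) struct set \<Rightarrow>
   (('f, 'r, 'p, 'u) struct \<Rightarrow> ('f, 'r, 'p, 'u) struct \<Rightarrow> bool) \<Rightarrow>
   'u list \<Rightarrow> 'u set \<Rightarrow> ('f, 'r, 'p, 'u) struct \<Rightarrow>
   ('u list \<times> 'u set \<times> ('f, 'r, 'p, 'u) struct) set" where
  "gtp L K leK b A N = {t. (E_at L K leK)\<^sup>+\<^sup>+ (b, A, N) t}"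

definition saturated_length_one ::
  "('f, 'r, 'p) lang \<Rightarrow> ('f, 'r, 'p, 'u) struct set \<Rightarrow>
   (('f, 'r, 'p, 'u) struct \<Rightarrow> ('f, 'r, 'p, 'u) struct \<Rightarrow> bool) \<Rightarrow>
   ('f, 'r, 'p, 'u) struct \<Rightarrow> 'c rel \<Rightarrow> 'u set \<Rightarrow> bool" where
  "saturated_length_one L K leK N lam X \<longleftrightarrow>
     X \<subseteq> carr N \<and>
     (\<forall>A c. A \<subseteq> X \<longrightarrow> |A| <o lam \<longrightarrow> c \<in> carr N \<longrightarrow>
        (\<exists>x \<in> X. gtp L K leK [x] A N = gtp L K leK [c] A N))"


section \<open>The independence relation\<close>

abbreviation models ::
  "(('f, 'r, 'p, 'u) struct \<Rightarrow> ('f, 'r, 'p, 'u) struct \<Rightarrow> bool) \<Rightarrow>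
   ('f, 'r, 'p, 'u) struct \<Rightarrow> ('f, 'r, 'p, 'u) struct set" where
  "models leK N \<equiv> {M. leK M N}"

text \<open>
  The local character cardinals \<open>\<kappa>\<^sub>\<alpha>\<close> and \<open>\<kappa>\<^sub>\<alpha>\<close>-bar need not exist a priori, so they are given as
  predicates on the cardinal \<open>\<mu>\<close> that is their value.  For the \<open>\<alpha> \<le> |'u|\<close> to which they are applied,
  if they exist then they are at most the successor of \<open>|'u|\<close> (which is infinite), hence are
  represented on \<open>'u set\<close>.  Likewise it suffices to let the regular \<open>\<delta>\<close> range over cardinals
  on \<open>'u set\<close>: a chain of regular length \<open>> |'u|\<close> is eventually constant, and eventually
  constant chains of length the successor of \<open>|'u|\<close> are included.
\<close>

definition is_local_card ::
  "(('f, 'r, 'p, 'u) struct \<Rightarrow> ('f, 'r, 'p, 'u) struct \<Rightarrow> bool) \<Rightarrow> ('f, 'r, 'p, 'u) struct \<Rightarrow>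
   (('f, 'r, 'p, 'u) struct \<Rightarrow> 'u set \<Rightarrow> 'u set \<Rightarrow> bool) \<Rightarrow> 'l rel \<Rightarrow> 'a rel \<Rightarrow> 'u set rel \<Rightarrow> bool" where
  "is_local_card leK N indep lam0 \<alpha> = least_card (\<lambda>\<mu>.
     cardSuc \<alpha> +c cardSuc lam0 \<le>o \<mu> \<and>
     (\<forall>M \<in> models leK N. \<forall>A \<subseteq> carr N. |A| \<le>o \<alpha> \<longrightarrow>
        (\<exists>M0 \<in> models leK N. leK M0 M \<and> |carr M0| <o \<mu> \<and> indep M0 A (carr M))))"

definition is_chain_local_card ::
  "(('f, 'r, 'p, 'u) struct \<Rightarrow> ('f, 'r, 'p, 'u) struct \<Rightarrow> bool) \<Rightarrow> ('f, 'r, 'p, 'u) struct \<Rightarrow>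
   (('f, 'r, 'p, 'u) struct \<Rightarrow> 'u set \<Rightarrow> 'u set \<Rightarrow> bool) \<Rightarrow> 'a rel \<Rightarrow> 'u set rel \<Rightarrow> bool" where
  "is_chain_local_card leK N indep \<alpha> = least_card (\<lambda>\<mu>.
     cardSuc \<alpha> +c natLeq \<le>o \<mu> \<and>
     (\<forall>(\<delta> :: 'u set rel) M A.
        Card_order \<delta> \<and> regularCard \<delta> \<and> \<mu> \<le>o \<delta> \<and> is_chain (models leK N) leK \<delta> M \<and>
        A \<subseteq> carr N \<and> |A| \<le>o \<alpha> \<longrightarrow>
        (\<exists>i \<in> Field \<delta>. indep (M i) A (chain_union \<delta> M))))"

text \<open>
  \<open>indep M A B\<close> reads ``\<open>A\<close> is independent from \<open>B\<close> over \<open>M\<close>''.  In \<open>local_character\<close>, \<open>\<alpha>\<close> ranges over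
  the cardinals \<open>\<le> |'u|\<close>; the bound for larger \<open>\<alpha>\<close> follows, as all sets are subsets of \<open>'u\<close>.
\<close>

locale independence_setting = coherent_abstract_class L K leK
  for L :: "('f, 'r, 'p) lang"
    and K :: "('f, 'r, 'p, 'u) struct set"
    and leK :: "('f, 'r, 'p, 'u) struct \<Rightarrow> ('f, 'r, 'p, 'u) struct \<Rightarrow> bool" +
  fixes \<kappa> :: "'k rel"
    and lam0 :: "'l rel"
    and N :: "('f, 'r, 'p, 'u) struct"
    and indep :: "('f, 'r, 'p, 'u) struct \<Rightarrow> 'u set \<Rightarrow> 'u set \<Rightarrow> bool"
  assumes kappa_infinite: "Cinfinite \<kappa>"
    and lam0_infinite: "Cinfinite lam0"
    and size_ge: "M \<in> K \<Longrightarrow> lam0 \<le>o |carr M|"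
    and N_in_class: "N \<in> K"
    and indep_domain: "indep M A B \<Longrightarrow> M \<in> models leK N \<and> A \<subseteq> carr N \<and> B \<subseteq> carr N"
    and invariance: "indep M A B \<Longrightarrow> iso L f N N \<Longrightarrow> iso L f M M' \<Longrightarrow> indep M' (f ` A) (f ` B)"
    and monotonicity: "indep M A B \<Longrightarrow> A0 \<subseteq> A \<Longrightarrow> B0 \<subseteq> B \<Longrightarrow> indep M A0 B0"
    and normality: "indep M A B \<Longrightarrow> indep M (A \<union> carr M) (B \<union> carr M)"
    and base_monotonicity: "indep M A B \<Longrightarrow> M' \<in> models leK N \<Longrightarrow> leK M M' \<Longrightarrow>
        carr M' \<subseteq> B \<union> carr M \<Longrightarrow> indep M' A B"
    and symmetry: "indep M A B \<Longrightarrow> indep M B A"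
    and strong_transitivity: "M0 \<in> models leK N \<Longrightarrow> M1 \<in> models leK N \<Longrightarrow>
        indep M0 A (carr M1) \<Longrightarrow> indep M1 A B \<Longrightarrow> indep M0 A B"
    and uniqueness: "\<And>M0 M (\<gamma> :: 'u set rel) M' B a b.
        M0 \<in> models leK N \<Longrightarrow> M \<in> models leK N \<Longrightarrow> leK M0 M \<Longrightarrow>
        is_chain (models leK N) leK \<gamma> M' \<Longrightarrow> B = chain_union \<gamma> M' \<Longrightarrow>
        carr M0 \<subseteq> B \<Longrightarrow> B \<subseteq> carr M \<Longrightarrow>
        set a \<subseteq> carr N \<Longrightarrow> set b \<subseteq> carr N \<Longrightarrow> length a \<le> 1 \<Longrightarrow> length b \<le> 1 \<Longrightarrow>
        gtp L K leK a (carr M0) N = gtp L K leK b (carr M0) N \<Longrightarrow>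
        indep M0 (set a) B \<Longrightarrow> indep M0 (set b) B \<Longrightarrow>
        gtp L K leK a B N = gtp L K leK b B N"
    and local_character: "\<And>\<alpha> :: 'u rel. Card_order \<alpha> \<Longrightarrow>
        \<exists>\<mu>. is_local_card leK N indep lam0 \<alpha> \<mu> \<and>
          \<mu> \<le>o cardSuc (cexp_less (\<alpha> +c lam0) (regular_above \<kappa>))"

end

theory Submission
  imports Defs
begin

text \<open>
  Let \<open>A\<close> be a small subset of the union and \<open>c\<close> an element.  If \<open>A\<close> lies in no \<open>M\<^sub>i\<close> then \<open>cf \<delta> \<le> |A|\<close>, so \<open>\<delta>\<close>
  may be taken to be a small regular cardinal.  Local character gives \<open>i\<^sub>0\<close> and a small model
  \<open>M' \<le> M\<^bsub>i\<^sub>0\<^esub>\<close> such that \<open>c\<close> is independent from the whole union over \<open>M'\<close>.  Alternate between small unions of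
  chains \<open>B\<^sub>j\<close> containing \<open>A\<close> and small models \<open>S\<^sub>j \<le> M\<^bsub>i\<^sub>0\<^esub>\<close> (\<open>j < \<delta>\<close>), increasing from \<open>M'\<close>, so that \<open>B\<^sub>j\<close> contains
  all \<open>S\<^sub>i\<close> with \<open>i < j\<close> and is independent from \<open>M\<^bsub>i\<^sub>0\<^esub>\<close> over \<open>S\<^sub>j\<close>.  Saturation yields \<open>x \<in> M\<^bsub>i\<^sub>0\<^esub>\<close> with the type of \<open>c\<close>
  over the union of the \<open>S\<^sub>j\<close>, and chain local character applied to \<open>S\<close> gives \<open>i\<close> with \<open>x\<close> independent from
  that union over \<open>S\<^sub>i\<close>.  For \<open>j > i\<close>, symmetry and strong transitivity through \<open>S\<^sub>j\<close> make \<open>x\<close> independent from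
  \<open>B\<^sub>j\<close> over \<open>S\<^sub>i\<close>, as is \<open>c\<close>; uniqueness then gives \<open>x\<close> and \<open>c\<close> the same type over \<open>B\<^sub>j\<close>, hence over \<open>A\<close>.

  Working with the successive models \<open>S\<^sub>j\<close> replaces homogeneity: equality of types alone would not
  transfer independence from \<open>c\<close> to \<open>x\<close>.
\<close>

section \<open>Cardinal arithmetic\<close>

lemma Card_order_not_ordLess:
  "Card_order \<mu> \<Longrightarrow> Card_order \<nu> \<Longrightarrow> \<not> \<mu> <o \<nu> \<Longrightarrow> \<nu> \<le>o \<mu>"
  by (rule iffD1[OF not_ordLess_iff_ordLeq[OF card_order_on_well_order_on card_order_on_well_order_on]])

text \<open>By well-foundedness of \<open><o\<close>. A single witness on the type makes the choices
  in \<open>cexp_less\<close> and \<open>regular_above\<close> meaningful.\<close>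

lemma least_card_exists:
  fixes \<nu> :: "'a rel"
  assumes "Card_order \<nu>" "P \<nu>"
  shows "\<exists>\<mu>. least_card P \<mu>"
proof -
  obtain \<mu> :: "'a rel" where \<mu>: "Card_order \<mu> \<and> P \<mu>"
    and min: "\<And>\<nu>. (\<nu>, \<mu>) \<in> ordLess \<Longrightarrow> \<not> (Card_order \<nu> \<and> P \<nu>)"
    using wfE_min[OF wf_ordLess, of \<nu> "{\<mu>. Card_order \<mu> \<and> P \<mu>}"] assms by auto
  have "\<mu> \<le>o \<nu>'" if "Card_order \<nu>'" "P \<nu>'" for \<nu>' :: "'a rel"
    using min[of \<nu>'] that \<mu> Card_order_not_ordLess by blast
  then show ?thesis unfolding least_card_def using \<mu> by blast
qed

text \<open>Copies a cardinal into the type of one that is at least as large. The definitions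
  quantify over cardinals of a fixed type; such copies carry their properties to other
  types.\<close>

lemma Card_order_ordLeq_obtain:
  fixes \<beta> :: "'a rel" and \<rho> :: "'b rel"
  assumes "Card_order \<beta>" "\<beta> \<le>o \<rho>"
  obtains X :: "'b set" where "X \<subseteq> Field \<rho>" "|X| =o \<beta>"
proof -
  have "|Field \<beta>| \<le>o \<rho>" using assms card_of_Field_ordIso ordIso_ordLeq_trans by blast
  then obtain B where B: "B \<subseteq> Field \<rho>" "|Field \<beta>| =o |B|"
    using iffD1[OF internalize_card_of_ordLeq] by blast
  show ?thesis
    by (rule that[OF B(1) ordIso_transitive[OF ordIso_symmetric[OF B(2)] card_of_Field_ordIso[OF assms(1)]]])
qed

lemma cexp_less_least_card:
  fixes \<chi> :: "'a rel" and \<rho> :: "'b rel"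
  shows "least_card (\<lambda>\<nu>. \<forall>\<beta> :: 'b rel. Card_order \<beta> \<and> \<beta> <o \<rho> \<longrightarrow> \<chi> ^c \<beta> \<le>o \<nu>) (cexp_less \<chi> \<rho>)"
  unfolding cexp_less_def
proof (rule someI_ex, rule least_card_exists)
  show "Card_order |UNIV :: ('b \<Rightarrow> 'a) set|" by (rule card_of_Card_order)
  show "\<forall>\<beta> :: 'b rel. Card_order \<beta> \<and> \<beta> <o \<rho> \<longrightarrow> \<chi> ^c \<beta> \<le>o |UNIV :: ('b \<Rightarrow> 'a) set|"
    by (simp add: cexp_def card_of_mono1)
qed

lemma Card_order_cexp_less: "Card_order (cexp_less \<chi> \<rho>)"
  using cexp_less_least_card unfolding least_card_def by blast

lemma cexp_ordLeq_cexp_less: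
  fixes \<rho> :: "'b rel" and \<beta> :: "'c rel"
  assumes "Card_order \<beta>" "\<beta> <o \<rho>" "Card_order \<chi>"
  shows "\<chi> ^c \<beta> \<le>o cexp_less \<chi> \<rho>"
proof -
  obtain X :: "'b set" where X: "|X| =o \<beta>"
    using Card_order_ordLeq_obtain[OF assms(1) ordLess_imp_ordLeq[OF assms(2)]] by blast
  have "\<chi> ^c |X| \<le>o cexp_less \<chi> \<rho>"
    using cexp_less_least_card[of \<rho> \<chi>] X assms(2) card_of_Card_order ordIso_ordLess_trans
    unfolding least_card_def by blast
  then show ?thesis
    using cexp_cong2[OF X assms(3)] card_of_Card_order ordIso_ordLeq_trans ordIso_symmetric by blast
qed

text \<open>The definition asserts minimality only among bounds on the function type. A strictly
  smaller \<open>\<nu>\<close> on another type has a copy there, which contradicts it.\<close>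

lemma cexp_less_ordLeq:
  fixes \<rho> :: "'b rel"
  assumes "Card_order \<nu>"
    and bound: "\<And>\<beta> :: 'b rel. Card_order \<beta> \<Longrightarrow> \<beta> <o \<rho> \<Longrightarrow> \<chi> ^c \<beta> \<le>o \<nu>"
  shows "cexp_less \<chi> \<rho> \<le>o \<nu>"
proof (rule ccontr)
  assume *: "\<not> cexp_less \<chi> \<rho> \<le>o \<nu>"
  have "\<nu> <o cexp_less \<chi> \<rho>"
    using * Card_order_not_ordLess[OF assms(1) Card_order_cexp_less] by blast
  then obtain X where X: "X \<subseteq> Field (cexp_less \<chi> \<rho>)" "|X| =o \<nu>"
    by (rule Card_order_ordLeq_obtain[OF assms(1) ordLess_imp_ordLeq])
  have "\<chi> ^c \<beta> \<le>o |X|" if "Card_order \<beta>" "\<beta> <o \<rho>" for \<beta> :: "'b rel"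
    by (rule ordLeq_ordIso_trans[OF bound[OF that] ordIso_symmetric[OF X(2)]])
  then have "cexp_less \<chi> \<rho> \<le>o |X|"
    using cexp_less_least_card[of \<rho> \<chi>] card_of_Card_order unfolding least_card_def by blast
  then show False using * ordLeq_ordIso_trans[OF _ X(2)] by blast
qed

lemma regular_above_least_card:
  fixes \<kappa> :: "'k rel"
  assumes "Cinfinite \<kappa>"
  shows "least_card (\<lambda>\<nu>. cinfinite \<nu> \<and> regularCard \<nu> \<and> \<kappa> \<le>o \<nu>) (regular_above \<kappa>)"
  unfolding regular_above_def
proof (rule someI_ex, rule least_card_exists)
  show "Card_order (cardSuc \<kappa>)" using assms cardSuc_Card_order by blast
  show "cinfinite (cardSuc \<kappa>) \<and> regularCard (cardSuc \<kappa>) \<and> \<kappa> \<le>o cardSuc \<kappa>"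
    using assms infinite_cardSuc_regularCard cardSuc_ordLeq cardSuc_finite
    unfolding cinfinite_def by blast
qed

lemma regularCard_bounded:
  assumes "Cinfinite \<rho>" "regularCard \<rho>" "Y \<subseteq> Field \<rho>" "|Y| <o \<rho>"
  obtains a where "a \<in> Field \<rho>" "\<And>b. b \<in> Y \<Longrightarrow> (b, a) \<in> \<rho>"
proof -
  have "\<not> cofinal Y \<rho>"
    using assms not_ordLess_ordIso unfolding regularCard_def by blast
  then obtain a where a: "a \<in> Field \<rho>" "\<And>b. b \<in> Y \<Longrightarrow> a = b \<or> (a, b) \<notin> \<rho>"
    unfolding cofinal_def by blast
  have wo: "wo_rel \<rho>" using assms(1) by (simp add: wo_rel_def card_order_on_well_order_on)
  have "(b, a) \<in> \<rho>" if "b \<in> Y" for b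
    using wo_rel.in_notinI[OF wo, of a b] a that assms(3) by blast
  then show ?thesis using that a by blast
qed

lemma cprod_ordLess_regularCard:
  assumes "Cinfinite \<rho>" "regularCard \<rho>" "|A| <o \<rho>" "|B| <o \<rho>"
  shows "|A \<times> B| <o \<rho>"
  using stable_elim[OF regularCard_stable, of \<rho> A "\<lambda>_. B"] assms unfolding cinfinite_def by blast

lemma ordLeq_cexp_less:
  assumes "Cinfinite \<rho>" "Card_order \<chi>"
  shows "\<chi> \<le>o cexp_less \<chi> \<rho>"
proof -
  have "cone <o \<rho>" using assms Cfinite_ordLess_Cinfinite Cfinite_cone by blast
  then have "\<chi> ^c cone \<le>o cexp_less \<chi> \<rho>"
    using cexp_ordLeq_cexp_less assms Card_order_cone by blast
  then show ?thesis using cexp_cone[OF assms(2)] ordIso_ordLeq_trans ordIso_symmetric by blast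
qed

text \<open>If the supremum \<open>?S\<close> were below \<open>\<rho>\<close>, it would itself be
  an admissible exponent, so 2 to the power \<open>?S\<close> would be at most \<open>?S\<close>,
  against Cantor.\<close>

lemma exponent_ordLeq_cexp_less:
  fixes \<rho> :: "'b rel" and \<chi> :: "'a rel"
  assumes "Cinfinite \<rho>" "Cinfinite \<chi>"
  shows "\<rho> \<le>o cexp_less \<chi> \<rho>"
proof (rule ccontr)
  let ?S = "cexp_less \<chi> \<rho>"
  assume "\<not> \<rho> \<le>o ?S"
  then have less: "?S <o \<rho>" using assms Card_order_not_ordLess Card_order_cexp_less by blast
  have "?S <o ctwo ^c ?S" by (rule ordLess_ctwo_cexp[OF Card_order_cexp_less])
  also have "ctwo ^c ?S \<le>o \<chi> ^c ?S"
    using assms(2) cexp_mono1 ctwo_ordLeq_Cinfinite Card_order_cexp_less by blast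
  also have "\<chi> ^c ?S \<le>o ?S"
    using cexp_ordLeq_cexp_less[OF Card_order_cexp_less less] assms by blast
  finally show False using ordLess_irreflexive by blast
qed

text \<open>Powers of 0 are 0 or 1. Hence the Loewenheim-Skolem bound for the empty set is finite if
  \<open>ls\<close> is.\<close>

lemma cexp_less_empty: "cexp_less |{} :: 'a set| (\<rho> :: 'b rel) \<le>o cone"
proof (rule cexp_less_ordLeq[OF Card_order_cone])
  fix \<beta> :: "'b rel"
  show "|{} :: 'a set| ^c \<beta> \<le>o cone"
    unfolding cexp_def cone_def Field_card_of
    by (rule card_of_ordLeqI[where f = "\<lambda>_. ()"]) (auto simp: inj_on_def Func_def fun_eq_iff)
qed

text \<open>
  For regular \<open>\<rho>\<close>, a family of fewer than \<open>\<rho>\<close> sequences of length \<open>< \<rho>\<close> has a common bound on the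
  lengths, hence is coded by a single sequence of length \<open>< \<rho>\<close>.  Sequences of length \<open>< \<rho>\<close> are
  represented as functions that are constantly \<open>e\<close> from some index on.
\<close>

lemma cexp_cexp_less_ordLeq:
  fixes \<rho> :: "'b rel" and \<chi> :: "'a rel"
  assumes \<rho>: "Cinfinite \<rho>" "regularCard \<rho>" and \<chi>: "Cinfinite \<chi>"
    and \<beta>: "Card_order \<beta>" "\<beta> <o \<rho>" and \<nu>: "\<nu> \<le>o cexp_less \<chi> \<rho>"
  shows "\<nu> ^c \<beta> \<le>o cexp_less \<chi> \<rho>"
proof -
  let ?S = "cexp_less \<chi> \<rho>"
  have S: "Cinfinite ?S"
    using Card_order_cexp_less ordLeq_cexp_less \<rho>(1) \<chi> cinfinite_mono by blast
  obtain e where e: "e \<in> Field \<chi>" using \<chi> unfolding cinfinite_def by fastforce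
  define G where "G \<gamma> = {g. (\<forall>\<xi>\<in>underS \<rho> \<gamma>. g \<xi> \<in> Field \<chi>) \<and> (\<forall>\<xi>. \<xi> \<notin> underS \<rho> \<gamma> \<longrightarrow> g \<xi> = e)}" for \<gamma>
  define T where "T = (\<Union>\<gamma>\<in>Field \<rho>. G \<gamma>)"
  have wo: "Well_order \<rho>" "wo_rel \<rho>"
    using \<rho>(1) by (simp_all add: wo_rel_def card_order_on_well_order_on)
  have G_mono: "G \<gamma> \<subseteq> G \<gamma>'" if "(\<gamma>, \<gamma>') \<in> \<rho>" for \<gamma> \<gamma>'
  proof -
    have "underS \<rho> \<gamma> \<subseteq> underS \<rho> \<gamma>'"
      using underS_incr[OF wo_rel.TRANS[OF wo(2)] wo_rel.ANTISYM[OF wo(2)] that] .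
    then show ?thesis unfolding G_def using e by (auto simp: subset_iff)
  qed
  have "\<chi> ^c \<eta> \<le>o |T|" if \<eta>: "Card_order \<eta>" "\<eta> <o \<rho>" for \<eta> :: "'b rel"
  proof -
    \<comment> \<open>An exponent below \<open>\<rho>\<close> is the size of a proper initial
      segment, so sequences indexed by such segments account for every power in the
      supremum.\<close>
    obtain \<gamma> where \<gamma>: "\<gamma> \<in> Field \<rho>" "\<eta> =o Restr \<rho> (underS \<rho> \<gamma>)"
      using iffD1[OF ordLess_iff_ordIso_Restr[OF wo(1) card_order_on_well_order_on[OF \<eta>(1)]] \<eta>(2)] by blast
    have "Field (Restr \<rho> (underS \<rho> \<gamma>)) = underS \<rho> \<gamma>"
      using Field_Restr_ofilter[OF wo(1)] wo_rel.underS_ofilter[OF wo(2)] by blast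
    then have iso: "|Field \<eta>| =o |underS \<rho> \<gamma>|" using card_of_cong[OF \<gamma>(2)] by simp
    have "\<chi> ^c \<eta> =o \<chi> ^c |underS \<rho> \<gamma>|"
      by (intro cexp_cong2 ordIso_transitive[OF _ iso] ordIso_symmetric[OF card_of_Field_ordIso])
        (use \<chi> \<eta> card_of_Card_order in auto)
    also have "\<chi> ^c |underS \<rho> \<gamma>| \<le>o |G \<gamma>|"
      unfolding cexp_def Field_card_of
    proof (rule card_of_ordLeqI)
      let ?h = "\<lambda>f \<xi>. if \<xi> \<in> underS \<rho> \<gamma> then f \<xi> else e"
      show "inj_on ?h (Func (underS \<rho> \<gamma>) (Field \<chi>))"
      proof (rule inj_onI, rule ext)
        fix f g \<xi> assume "f \<in> Func (underS \<rho> \<gamma>) (Field \<chi>)" "g \<in> Func (underS \<rho> \<gamma>) (Field \<chi>)"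
          and "?h f = ?h g"
        then show "f \<xi> = g \<xi>" using fun_cong[of "?h f" "?h g" \<xi>] unfolding Func_def
          by (cases "\<xi> \<in> underS \<rho> \<gamma>") auto
      qed
      show "?h f \<in> G \<gamma>" if "f \<in> Func (underS \<rho> \<gamma>) (Field \<chi>)" for f
        using that unfolding G_def Func_def by auto
    qed
    also have "|G \<gamma>| \<le>o |T|" unfolding T_def using \<gamma>(1) by (intro card_of_mono1) blast
    finally show ?thesis .
  qed
  then have "?S \<le>o |T|" by (intro cexp_less_ordLeq card_of_Card_order)
  then have "\<nu> ^c \<beta> \<le>o |T| ^c \<beta>" using \<nu> cexp_mono1[OF _ \<beta>(1)] ordLeq_transitive by blast
  moreover have "|T| ^c \<beta> \<le>o ?S"
  proof -
    have "Func (Field \<beta>) T \<subseteq> (\<Union>\<gamma>\<in>Field \<rho>. Func (Field \<beta>) (G \<gamma>))"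
    proof
      fix F assume F: "F \<in> Func (Field \<beta>) T"
      then have "\<forall>b\<in>Field \<beta>. \<exists>\<gamma>\<in>Field \<rho>. F b \<in> G \<gamma>" unfolding Func_def T_def by blast
      then obtain l where l: "\<And>b. b \<in> Field \<beta> \<Longrightarrow> l b \<in> Field \<rho> \<and> F b \<in> G (l b)" by metis
      have "|l ` Field \<beta>| <o \<rho>"
        using ordLeq_ordLess_trans[OF card_of_image ordLess_Field[OF \<beta>(2)]] .
      then obtain \<gamma> where \<gamma>: "\<gamma> \<in> Field \<rho>" "\<And>b. b \<in> l ` Field \<beta> \<Longrightarrow> (b, \<gamma>) \<in> \<rho>"
        using regularCard_bounded[OF \<rho>, of "l ` Field \<beta>"] l by blast
      then have "F \<in> Func (Field \<beta>) (G \<gamma>)" using F l G_mono unfolding Func_def by blast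
      then show "F \<in> (\<Union>\<gamma>\<in>Field \<rho>. Func (Field \<beta>) (G \<gamma>))" using \<gamma> by blast
    qed
    then have "|T| ^c \<beta> \<le>o |\<Union>\<gamma>\<in>Field \<rho>. Func (Field \<beta>) (G \<gamma>)|"
      unfolding cexp_def Field_card_of by (rule card_of_mono1)
    also have "|\<Union>\<gamma>\<in>Field \<rho>. Func (Field \<beta>) (G \<gamma>)| \<le>o ?S"
    proof (rule UNION_Cinfinite_bound[OF _ _ S])
      show "|Field \<rho>| \<le>o ?S"
        using exponent_ordLeq_cexp_less[OF \<rho>(1) \<chi>] card_of_Field_ordIso \<rho>(1) ordIso_ordLeq_trans by blast
      show "\<forall>\<gamma>\<in>Field \<rho>. |Func (Field \<beta>) (G \<gamma>)| \<le>o ?S"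
      proof
        fix \<gamma> assume \<gamma>: "\<gamma> \<in> Field \<rho>"
        \<comment> \<open>Currying: a family of sequences indexed by \<open>\<beta>\<close> is one
          function on a product, and the product stays below the regular
          \<open>\<rho>\<close>.\<close>
        let ?P = "Field \<beta> \<times> underS \<rho> \<gamma>"
        let ?h = "\<lambda>F p. if p \<in> ?P then F (fst p) (snd p) else undefined"
        have "|Func (Field \<beta>) (G \<gamma>)| \<le>o \<chi> ^c |?P|"
          unfolding cexp_def Field_card_of
        proof (rule card_of_ordLeqI)
          show "inj_on ?h (Func (Field \<beta>) (G \<gamma>))"
          proof (rule inj_onI, rule ext, rule ext)
            fix F F' b \<xi> assume F: "F \<in> Func (Field \<beta>) (G \<gamma>)" "F' \<in> Func (Field \<beta>) (G \<gamma>)"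
              and eq: "?h F = ?h F'"
            show "F b \<xi> = F' b \<xi>"
              using fun_cong[OF eq, of "(b, \<xi>)"] F unfolding Func_def G_def
              by (cases "b \<in> Field \<beta>"; cases "\<xi> \<in> underS \<rho> \<gamma>") auto
          qed
          show "?h F \<in> Func ?P (Field \<chi>)" if "F \<in> Func (Field \<beta>) (G \<gamma>)" for F
            using that unfolding Func_def G_def by auto
        qed
        also have "\<chi> ^c |?P| \<le>o ?S"
        proof (rule cexp_ordLeq_cexp_less[OF card_of_Card_order])
          show "|?P| <o \<rho>"
            using cprod_ordLess_regularCard[OF \<rho> ordLess_Field[OF \<beta>(2)] card_of_underS] \<gamma> \<rho>(1) by simp
          show "Card_order \<chi>" using \<chi> by blast
        qed
        finally show "|Func (Field \<beta>) (G \<gamma>)| \<le>o ?S" .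
      qed
    qed
    finally show ?thesis .
  qed
  ultimately show ?thesis by (rule ordLeq_transitive)
qed

text \<open>Every single power is absorbed, hence so is their supremum. This closure later keeps
  hulls and bases at size at most \<open>\<mu>\<close>.\<close>

lemma cexp_less_cexp_less_ordLeq:
  fixes \<rho> :: "'b rel" and \<rho>' :: "'c rel" and \<chi> :: "'a rel"
  assumes "Cinfinite \<rho>" "regularCard \<rho>" "Cinfinite \<chi>" "\<rho>' \<le>o \<rho>" "\<nu> \<le>o cexp_less \<chi> \<rho>"
  shows "cexp_less \<nu> \<rho>' \<le>o cexp_less \<chi> \<rho>"
  using assms cexp_cexp_less_ordLeq ordLess_ordLeq_trans
  by (intro cexp_less_ordLeq Card_order_cexp_less) blast

section \<open>Cofinality\<close>

lemma cofinality_properties: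
  assumes "Well_order r"
  shows "\<exists>C. unbounded_in C r \<and> cofinality r = |C|"
    and "unbounded_in C r \<Longrightarrow> cofinality r \<le>o |C|"
proof -
  let ?Q = "{|C| | C. unbounded_in C r}"
  have "unbounded_in (Field r) r"
    using assms unfolding unbounded_in_def order_on_defs by (auto dest: refl_onD)
  then have Field_Q: "|Field r| \<in> ?Q" by blast
  obtain \<mu> where \<mu>: "\<mu> \<in> ?Q" and min: "\<forall>\<nu>. (\<nu>, \<mu>) \<in> ordLess \<longrightarrow> \<nu> \<notin> ?Q"
    using wf_ordLess[unfolded wf_eq_minimal, THEN spec, THEN spec, THEN mp, OF Field_Q] by (rule bexE)
  have "\<mu> \<le>o |C|" if "unbounded_in C r" for C
    using Card_order_not_ordLess[of "|C|" \<mu>] min[THEN spec, of "|C|"] that \<mu> card_of_Card_order by auto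
  then have "(\<exists>C. unbounded_in C r \<and> \<mu> = |C| ) \<and> (\<forall>C. unbounded_in C r \<longrightarrow> \<mu> \<le>o |C| )"
    using \<mu> by blast
  then have *: "(\<exists>C. unbounded_in C r \<and> cofinality r = |C| ) \<and> (\<forall>C. unbounded_in C r \<longrightarrow> cofinality r \<le>o |C| )"
    unfolding cofinality_def by (rule someI)
  show "\<exists>C. unbounded_in C r \<and> cofinality r = |C|" using * by blast
  show "unbounded_in C r \<Longrightarrow> cofinality r \<le>o |C|" using * by blast
qed

text \<open>Enumerate an unbounded set of least size by \<open>e\<close> along
  \<open>\<theta>\<close> and let \<open>h i\<close> be the least upper bound of the values up to
  \<open>i\<close>. It exists because these values are fewer than the cofinality. As
  \<open>h\<close> sends cofinal sets to unbounded ones, \<open>\<theta>\<close> is regular.\<close>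

lemma cofinal_reindexing:
  fixes \<delta> :: "'d rel" and \<theta> :: "'e rel"
  assumes wo: "Well_order \<delta>" and \<theta>: "Cinfinite \<theta>" and iso: "\<theta> =o cofinality \<delta>"
  obtains h where "regularCard \<theta>" "\<And>i. i \<in> Field \<theta> \<Longrightarrow> h i \<in> Field \<delta>"
    "\<And>i j. (i, j) \<in> \<theta> \<Longrightarrow> (h i, h j) \<in> \<delta>"
    "\<And>a. a \<in> Field \<delta> \<Longrightarrow> \<exists>i\<in>Field \<theta>. (a, h i) \<in> \<delta>"
proof -
  have wo\<delta>: "wo_rel \<delta>" and wo\<theta>: "wo_rel \<theta>"
    using wo \<theta> by (simp_all add: wo_rel_def card_order_on_well_order_on)
  obtain C where C: "unbounded_in C \<delta>" "cofinality \<delta> = |C|" using cofinality_properties(1)[OF wo] by blast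
  have "|Field \<theta>| =o |C|"
    using ordIso_transitive[OF card_of_Field_ordIso iso] \<theta> C(2) by simp
  then obtain e where e: "bij_betw e (Field \<theta>) C" using card_of_ordIso by blast
  have C_Field: "C \<subseteq> Field \<delta>" using C(1) unfolding unbounded_in_def by blast
  define U where "U i = {a \<in> Field \<delta>. \<forall>s\<in>e ` under \<theta> i. (s, a) \<in> \<delta>}" for i
  define h where "h i = wo_rel.minim \<delta> (U i)" for i
  have under_Field: "under \<theta> i \<subseteq> Field \<theta>" for i by (rule under_Field)
  have U_ne: "U i \<noteq> {}" if i: "i \<in> Field \<theta>" for i
  proof -
    \<comment> \<open>An infinite cardinal has no last element, so the closed segment up to
      \<open>i\<close> lies in an open one and has size below \<open>\<theta>\<close>.\<close>
    obtain j where j: "j \<in> Field \<theta>" "i \<noteq> j" "(i, j) \<in> \<theta>"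
      using infinite_Card_order_limit[of \<theta> i] \<theta> i unfolding cinfinite_def by blast
    have "under \<theta> i \<subseteq> underS \<theta> j"
      using j wo_rel.TRANS[OF wo\<theta>] wo_rel.ANTISYM[OF wo\<theta>]
      unfolding under_def underS_def trans_def antisym_def by blast
    then have "|under \<theta> i| \<le>o |underS \<theta> j|" by (rule card_of_mono1)
    also have "|underS \<theta> j| <o \<theta>" using card_of_underS[OF _ j(1)] \<theta> by blast
    also note iso
    finally have "|e ` under \<theta> i| <o cofinality \<delta>" by (rule ordLeq_ordLess_trans[OF card_of_image])
    then have "\<not> unbounded_in (e ` under \<theta> i) \<delta>"
      using cofinality_properties(2)[OF wo, of "e ` under \<theta> i"] not_ordLess_ordLeq by blast
    moreover have sub: "e ` under \<theta> i \<subseteq> Field \<delta>"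
      using e under_Field C_Field unfolding bij_betw_def by blast
    ultimately obtain a where a: "a \<in> Field \<delta>" "\<And>b. b \<in> e ` under \<theta> i \<Longrightarrow> (a, b) \<notin> \<delta>"
      unfolding unbounded_in_def by blast
    then have "a \<in> U i"
      unfolding U_def using sub wo_rel.in_notinI[OF wo\<delta>] by blast
    then show ?thesis by blast
  qed
  have U_sub: "U i \<subseteq> Field \<delta>" for i unfolding U_def by blast
  have h_U: "h i \<in> U i" if "i \<in> Field \<theta>" for i
    unfolding h_def by (rule wo_rel.minim_in[OF wo\<delta> U_sub U_ne[OF that]])
  have h_Field: "h i \<in> Field \<delta>" if "i \<in> Field \<theta>" for i using h_U[OF that] U_sub by blast
  have h_mono: "(h i, h j) \<in> \<delta>" if "(i, j) \<in> \<theta>" for i j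
  proof -
    have "under \<theta> i \<subseteq> under \<theta> j"
      using that wo_rel.TRANS[OF wo\<theta>] unfolding under_def trans_def by blast
    then have sub: "U j \<subseteq> U i" unfolding U_def by auto
    have "h j \<in> U i" by (rule subsetD[OF sub h_U[OF FieldI2[OF that]]])
    then show ?thesis unfolding h_def[of i] by (rule wo_rel.minim_least[OF wo\<delta> U_sub[of i]])
  qed
  have h_cofinal: "\<exists>i\<in>Field \<theta>. (a, h i) \<in> \<delta>" if a: "a \<in> Field \<delta>" for a
  proof -
    obtain c where c: "c \<in> C" "(a, c) \<in> \<delta>" using C(1) a unfolding unbounded_in_def by blast
    then obtain i where i: "i \<in> Field \<theta>" "c = e i" using e unfolding bij_betw_def by blast
    have "i \<in> under \<theta> i"
      using i(1) wo_rel.REFL[OF wo\<theta>] unfolding under_def refl_on_def by blast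
    then have "(c, h i) \<in> \<delta>" using h_U[OF i(1)] i(2) unfolding U_def by blast
    then show ?thesis using c(2) i(1) wo_rel.TRANS[OF wo\<delta>] unfolding trans_def by blast
  qed
  have "regularCard \<theta>"
    unfolding regularCard_def
  proof (intro allI impI)
    fix Y assume Y: "Y \<subseteq> Field \<theta> \<and> cofinal Y \<theta>"
    have "unbounded_in (h ` Y) \<delta>"
      unfolding unbounded_in_def
    proof (intro conjI ballI)
      show "h ` Y \<subseteq> Field \<delta>" using Y h_Field by blast
      fix a assume "a \<in> Field \<delta>"
      then obtain i where i: "i \<in> Field \<theta>" "(a, h i) \<in> \<delta>" using h_cofinal by blast
      then obtain b where b: "b \<in> Y" "(i, b) \<in> \<theta>" using Y unfolding cofinal_def by blast
      then show "\<exists>b\<in>h ` Y. (a, b) \<in> \<delta>"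
        using i(2) h_mono[OF b(2)] wo_rel.TRANS[OF wo\<delta>] unfolding trans_def by blast
    qed
    then have "cofinality \<delta> \<le>o |h ` Y|" by (rule cofinality_properties(2)[OF wo])
    then have "\<theta> \<le>o |h ` Y|" by (rule ordIso_ordLeq_trans[OF iso])
    then have "\<theta> \<le>o |Y|" by (rule ordLeq_transitive[OF _ card_of_image])
    moreover have "|Y| \<le>o \<theta>"
      using ordLeq_ordIso_trans[OF card_of_mono1[of Y "Field \<theta>"] card_of_Field_ordIso] Y \<theta> by simp
    ultimately show "|Y| =o \<theta>" using ordIso_iff_ordLeq by blast
  qed
  then show ?thesis by (rule that[OF _ h_Field h_mono h_cofinal])
qed

text \<open>Choose for each element of \<open>A\<close> an index whose set contains it. If some
  \<open>i\<close> bounded all these indices, \<open>A\<close> would lie in \<open>X i\<close>; so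
  they are unbounded.\<close>

lemma cofinality_ordLeq_of_cover:
  assumes wo: "Well_order r" and mono: "\<And>i j. (i, j) \<in> r \<Longrightarrow> X i \<subseteq> X j"
    and A: "A \<subseteq> (\<Union>i\<in>Field r. X i)" and not_sub: "\<And>i. i \<in> Field r \<Longrightarrow> \<not> A \<subseteq> X i"
  shows "cofinality r \<le>o |A|"
proof -
  have wo': "wo_rel r" using wo by (simp add: wo_rel_def)
  obtain f where f: "\<And>a. a \<in> A \<Longrightarrow> f a \<in> Field r \<and> a \<in> X (f a)"
    using bchoice[of A "\<lambda>a i. i \<in> Field r \<and> a \<in> X i"] A by auto
  have "unbounded_in (f ` A) r"
    unfolding unbounded_in_def
  proof (intro conjI ballI)
    show "f ` A \<subseteq> Field r" using f by blast
    fix i assume i: "i \<in> Field r"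
    obtain a where a: "a \<in> A" "a \<notin> X i" using not_sub[OF i] by blast
    have "(f a, i) \<notin> r" using mono[of "f a" i] f[OF a(1)] a(2) by blast
    then have "(i, f a) \<in> r" using wo_rel.in_notinI[OF wo', of "f a" i] f[OF a(1)] i by simp
    then show "\<exists>b\<in>f ` A. (i, b) \<in> r" using a(1) by blast
  qed
  then have "cofinality r \<le>o |f ` A|" by (rule cofinality_properties(2)[OF wo])
  then show ?thesis by (rule ordLeq_transitive[OF _ card_of_image])
qed

section \<open>Galois types and chains of small models\<close>

context coherent_abstract_class
begin

lemma le_carr: "leK M M' \<Longrightarrow> carr M \<subseteq> carr M'"
  using le_substruct unfolding substruct_def by blast

text \<open>Both models inherit their structure from \<open>M\<close>, so inclusion of the carriers
  makes one a substructure of the other and coherence applies.\<close>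

lemma le_of_subset:
  assumes "leK M0 M" "leK M1 M" "carr M0 \<subseteq> carr M1"
  shows "leK M0 M1"
proof (rule coherence[OF _ assms(2,1)])
  have sub: "tuples I (carr M0) \<subseteq> tuples I (carr M1)" for I :: "'p set"
    using assms(3) by (intro PiE_mono)
  have "fn_of M0 g x = fn_of M1 g x" if "g \<in> funs L" "x \<in> tuples (far L g) (carr M0)" for g x
    using le_substruct[OF assms(1)] le_substruct[OF assms(2)] that subsetD[OF sub that(2)]
    unfolding substruct_def by simp
  moreover have "rel_of M0 s = rel_of M1 s \<inter> tuples (rar L s) (carr M0)" if "s \<in> rels L" for s
  proof -
    have "rel_of M0 s = rel_of M s \<inter> tuples (rar L s) (carr M0)"
      and "rel_of M1 s = rel_of M s \<inter> tuples (rar L s) (carr M1)"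
      using le_substruct[OF assms(1)] le_substruct[OF assms(2)] that unfolding substruct_def by simp_all
    then show ?thesis using Int_absorb1[OF sub[of "rar L s"]] by (simp add: Int_assoc)
  qed
  ultimately show "substruct L M0 M1"
    using le_substruct[OF assms(1)] le_substruct[OF assms(2)] assms(3)
    unfolding substruct_def by simp
qed

lemma E_at_refl:
  assumes "N \<in> K" "A \<subseteq> carr N" "set b \<subseteq> carr N"
  shows "E_at L K leK (b, A, N) (b, A, N)"
proof -
  have "iso L id N N"
    unfolding iso_def using structures[OF assms(1)] by (simp add: PiE_restrict cong: restrict_cong)
  then have "K_embedding L leK id N N"
    unfolding K_embedding_def using le_refl[OF assms(1)] by blast
  then show ?thesis unfolding E_at_def using assms
    by (auto intro!: exI[of _ N] exI[of _ id])
qed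

lemma E_at_mono:
  assumes "E_at L K leK (b, A, N) (b', A', N')" "A0 \<subseteq> A"
  shows "A' = A \<and> E_at L K leK (b, A0, N) (b', A0, N')"
  using assms unfolding E_at_def by auto blast

lemma E_at_tranclp_mono:
  assumes "(E_at L K leK)\<^sup>+\<^sup>+ (b, A, N) (b', A', N')" "A0 \<subseteq> A"
  shows "A' = A \<and> (E_at L K leK)\<^sup>+\<^sup>+ (b, A0, N) (b', A0, N')"
  using assms(1)
proof (induction "(b', A', N')" arbitrary: b' A' N' rule: tranclp_induct)
  case base
  then show ?case using E_at_mono assms(2) by blast
next
  case (step y)
  obtain b1 A1 N1 where y: "y = (b1, A1, N1)" by (cases y)
  have IH: "A1 = A" "(E_at L K leK)\<^sup>+\<^sup>+ (b, A0, N) (b1, A0, N1)" using step(3)[OF y] by auto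
  have "A' = A1 \<and> E_at L K leK (b1, A0, N1) (b', A0, N')"
    by (rule E_at_mono) (use step(2) y IH(1) assms(2) in auto)
  then show ?case using IH by (auto intro: tranclp.trancl_into_trancl)
qed

text \<open>An amalgam fixing \<open>A\<close> pointwise fixes \<open>A0\<close>, so every chain of
  atomic equivalences restricts. Reflexivity turns equality of the classes into such chains.\<close>

lemma gtp_mono:
  assumes "gtp L K leK b A N = gtp L K leK b' A N" "A0 \<subseteq> A"
    and "N \<in> K" "A \<subseteq> carr N" "set b \<subseteq> carr N" "set b' \<subseteq> carr N"
  shows "gtp L K leK b A0 N = gtp L K leK b' A0 N"
proof -
  have "(b, A, N) \<in> gtp L K leK b A N" "(b', A, N) \<in> gtp L K leK b' A N"
    unfolding gtp_def using E_at_refl assms(3-6) by blast+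
  then have "(b, A, N) \<in> gtp L K leK b' A N" "(b', A, N) \<in> gtp L K leK b A N"
    using assms(1) by simp_all
  then have "(E_at L K leK)\<^sup>+\<^sup>+ (b, A0, N) (b', A0, N)" "(E_at L K leK)\<^sup>+\<^sup>+ (b', A0, N) (b, A0, N)"
    unfolding gtp_def using E_at_tranclp_mono[OF _ assms(2)] by blast+
  then show ?thesis unfolding gtp_def by (auto intro: tranclp_trans)
qed

text \<open>Transfinite recursion: \<open>F i\<close> is applied to the union of the earlier
  carriers, also at limits, where that union need not be a model. The recursion equation is part of
  the conclusion so that further properties of \<open>F\<close> can be read off at each
  stage.\<close>

lemma chain_of_small_models:
  fixes r :: "'d rel" and P :: "'d \<Rightarrow> ('f, 'r, 'p, 'u) struct"
  assumes chain: "is_chain C leK r P" and \<mu>: "Cinfinite \<mu>" "|Field r| \<le>o \<mu>"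
    and F: "\<forall>i\<in>Field r. \<forall>Y. Y \<subseteq> carr (P i) \<and> |Y| \<le>o \<mu> \<longrightarrow>
      leK (F i Y) (P i) \<and> Y \<subseteq> carr (F i Y) \<and> |carr (F i Y)| \<le>o \<mu>"
  shows "\<exists>Q. (\<forall>i\<in>Field r. Q i = F i (\<Union>j\<in>underS r i. carr (Q j)) \<and>
        (\<Union>j\<in>underS r i. carr (Q j)) \<subseteq> carr (P i) \<and> |\<Union>j\<in>underS r i. carr (Q j)| \<le>o \<mu> \<and>
        leK (Q i) (P i) \<and> |carr (Q i)| \<le>o \<mu>) \<and>
      (\<forall>i j. (i, j) \<in> r \<longrightarrow> leK (Q i) (Q j))"
proof -
  have ext: "leK (F i Y) (P i) \<and> Y \<subseteq> carr (F i Y) \<and> |carr (F i Y)| \<le>o \<mu>"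
    if "i \<in> Field r" "Y \<subseteq> carr (P i)" "|Y| \<le>o \<mu>" for i Y
    using F that by blast
  have wo: "wo_rel r" using chain unfolding is_chain_def wo_rel_def by blast
  have P_mono: "leK (P i) (P j)" if "(i, j) \<in> r" for i j using chain that unfolding is_chain_def by blast
  define H where "H Q i = F i (\<Union>j\<in>underS r i. carr (Q j))" for Q :: "'d \<Rightarrow> ('f, 'r, 'p, 'u) struct" and i
  define Q where "Q = wo_rel.worec r H"
  have adm: "wo_rel.adm_wo r H" unfolding wo_rel.adm_wo_def[OF wo] H_def by auto
  have Q: "Q i = F i (\<Union>j\<in>underS r i. carr (Q j))" for i
    using fun_cong[OF wo_rel.worec_fixpoint[OF wo adm], of i] unfolding Q_def[symmetric] H_def .
  have step: "(\<Union>j\<in>underS r i. carr (Q j)) \<subseteq> carr (P i) \<and> |\<Union>j\<in>underS r i. carr (Q j)| \<le>o \<mu> \<and>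
      leK (Q i) (P i) \<and> |carr (Q i)| \<le>o \<mu>" if "i \<in> Field r" for i
    using that
  proof (induction i rule: wo_rel.well_order_induct[OF wo])
    case (1 i)
    have IH: "leK (Q j) (P j) \<and> |carr (Q j)| \<le>o \<mu>" if "j \<in> underS r i" for j
      using 1(1) that unfolding underS_def by (auto simp: Field_def)
    let ?Y = "\<Union>j\<in>underS r i. carr (Q j)"
    have "?Y \<subseteq> carr (P i)"
      using IH le_carr P_mono unfolding underS_def by blast
    moreover have "|?Y| \<le>o \<mu>"
    proof (rule UNION_Cinfinite_bound[OF _ _ \<mu>(1)])
      show "|underS r i| \<le>o \<mu>"
        using ordLeq_transitive[OF card_of_mono1[OF Order_Relation.underS_Field] \<mu>(2)] .
    qed (use IH in blast)
    ultimately show ?case using ext[OF 1(2)] Q[of i] by simp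
  qed
  have Q_mono: "leK (Q i) (Q j)" if "(i, j) \<in> r" for i j
  proof -
    have F: "i \<in> Field r" "j \<in> Field r" using that by (auto simp: Field_def)
    have "carr (Q i) \<subseteq> carr (Q j)"
    proof (cases "i = j")
      case False
      then have "carr (Q i) \<subseteq> (\<Union>l\<in>underS r j. carr (Q l))" using that unfolding underS_def by blast
      also have "\<dots> \<subseteq> carr (Q j)" using ext[OF F(2)] step[OF F(2)] Q[of j] by simp
      finally show ?thesis .
    qed simp
    moreover have "leK (Q i) (P j)" using step[OF F(1)] P_mono[OF that] le_trans by blast
    ultimately show ?thesis using le_of_subset step[OF F(2)] by blast
  qed
  show ?thesis
  proof (intro exI[of _ Q] conjI ballI allI impI)
    show "Q i = F i (\<Union>j\<in>underS r i. carr (Q j))" for i by (rule Q)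
  qed (use step Q_mono in blast)+
qed

end

section \<open>Saturation of unions\<close>

text \<open>The case of a chain of infinite length at most \<open>\<mu>\<close>. The cardinal
  arithmetic is condensed into two hypotheses: sets of size at most \<open>\<mu>\<close> have hulls
  and bases of size at most \<open>\<mu>\<close>.\<close>

lemma (in independence_setting) type_realized_in_union:
  fixes \<theta> :: "'u set rel" and P :: "'u set \<Rightarrow> ('f, 'r, 'p, 'u) struct"
  assumes small_model: "\<And>M Y. M \<in> K \<Longrightarrow> Y \<subseteq> carr M \<Longrightarrow> |Y| \<le>o \<mu> \<Longrightarrow>
      \<exists>M0. leK M0 M \<and> Y \<subseteq> carr M0 \<and> |carr M0| \<le>o \<mu>"
    and small_base: "\<And>M Y. leK M N \<Longrightarrow> Y \<subseteq> carr N \<Longrightarrow> |Y| \<le>o \<mu> \<Longrightarrow>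
      \<exists>M0. leK M0 M \<and> |carr M0| \<le>o \<mu> \<and> indep M0 Y (carr M)"
    and \<mu>: "Cinfinite \<mu>"
    and \<theta>: "Cinfinite \<theta>" "|Field \<theta>| \<le>o \<mu>"
    and chain_local: "\<And>M Y. is_chain (models leK N) leK \<theta> M \<Longrightarrow> Y \<subseteq> carr N \<Longrightarrow> |Y| \<le>o cone \<Longrightarrow>
      \<exists>i\<in>Field \<theta>. indep (M i) Y (chain_union \<theta> M)"
    and P: "is_chain (models leK N) leK \<theta> P"
    and saturated: "\<And>i Y. i \<in> Field \<theta> \<Longrightarrow> Y \<subseteq> carr (P i) \<Longrightarrow> |Y| \<le>o \<mu> \<Longrightarrow>
      \<exists>x\<in>carr (P i). gtp L K leK [x] Y N = gtp L K leK [c] Y N"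
    and A: "A \<subseteq> chain_union \<theta> P" "|A| \<le>o \<mu>" and c: "c \<in> carr N"
  shows "\<exists>x\<in>chain_union \<theta> P. gtp L K leK [x] A N = gtp L K leK [c] A N"
proof -
  have P_N: "leK (P i) N" if "i \<in> Field \<theta>" for i using P that unfolding is_chain_def by blast
  have P_K: "P i \<in> K" if "i \<in> Field \<theta>" for i using P_N[OF that] le_in_class by blast
  have union_N: "chain_union \<theta> P \<subseteq> carr N" using P_N le_carr by blast
  have singleton: "|{x :: 'u}| \<le>o cone" "|{x :: 'u}| \<le>o \<mu>" for x
  proof -
    show *: "|{x}| \<le>o cone" unfolding cone_def by (rule card_of_singl_ordLeq) simp
    show "|{x}| \<le>o \<mu>"
      using ordLeq_transitive[OF * cone_ordLeq_Cnotzero[OF Cinfinite_Cnotzero[OF \<mu>]]] .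
  qed

  \<comment> \<open>A small base for \<open>c\<close>\<close>
  obtain i0 where i0: "i0 \<in> Field \<theta>" "indep (P i0) {c} (chain_union \<theta> P)"
    using chain_local[OF P, of "{c}"] c singleton(1) by blast
  let ?M = "P i0"
  obtain M0 where M0: "leK M0 ?M" "|carr M0| \<le>o \<mu>" "indep M0 {c} (carr ?M)"
    using small_base[OF P_N[OF i0(1)], of "{c}"] c singleton(2) by blast
  \<comment> \<open>\<open>M0\<close> is only a base against \<open>P i0\<close>; transitivity
    through \<open>P i0\<close> extends the independence to the whole union.\<close>
  have c_M0: "indep M0 {c} (chain_union \<theta> P)"
    using strong_transitivity[OF _ _ M0(3) i0(2)] M0(1) P_N[OF i0(1)] le_trans by blast

  \<comment> \<open>Small unions of chains around \<open>A\<close>\<close>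
  have chain_hull: "\<exists>Q. is_chain (models leK N) leK \<theta> Q \<and> A \<union> X \<subseteq> chain_union \<theta> Q \<and>
      chain_union \<theta> Q \<subseteq> chain_union \<theta> P \<and> |chain_union \<theta> Q| \<le>o \<mu>"
    if X: "X \<subseteq> chain_union \<theta> P" "|X| \<le>o \<mu>" for X
  proof -
    \<comment> \<open>Uniqueness speaks of unions of chains of models, so the hull is built as a
      chain: its \<open>i\<close>-th member takes up the part of the given set that lies in
      \<open>P i\<close>.\<close>
    let ?Z = "\<lambda>i Y. Y \<union> (A \<union> X) \<inter> carr (P i)"
    have "\<exists>M'. leK M' (P i) \<and> ?Z i Y \<subseteq> carr M' \<and> |carr M'| \<le>o \<mu>"
      if "i \<in> Field \<theta>" "Y \<subseteq> carr (P i)" "|Y| \<le>o \<mu>" for i Y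
    proof (rule small_model[OF P_K[OF that(1)]])
      show "?Z i Y \<subseteq> carr (P i)" using that(2) by blast
      have "|A \<union> X| \<le>o \<mu>" by (rule Un_Cinfinite_bound[OF A(2) X(2) \<mu>])
      then have "|(A \<union> X) \<inter> carr (P i)| \<le>o \<mu>"
        using ordLeq_transitive[OF card_of_mono1[OF Int_lower1]] by blast
      then show "|?Z i Y| \<le>o \<mu>" by (rule Un_Cinfinite_bound[OF that(3) _ \<mu>])
    qed
    note small = this
    define F where "F i Y = (SOME M'. leK M' (P i) \<and> ?Z i Y \<subseteq> carr M' \<and> |carr M'| \<le>o \<mu>)" for i Y
    have F: "leK (F i Y) (P i) \<and> ?Z i Y \<subseteq> carr (F i Y) \<and> |carr (F i Y)| \<le>o \<mu>"
      if "i \<in> Field \<theta>" "Y \<subseteq> carr (P i)" "|Y| \<le>o \<mu>" for i Y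
      unfolding F_def by (rule someI_ex[OF small[OF that]])
    then have F_ext: "\<forall>i\<in>Field \<theta>. \<forall>Y. Y \<subseteq> carr (P i) \<and> |Y| \<le>o \<mu> \<longrightarrow>
        leK (F i Y) (P i) \<and> Y \<subseteq> carr (F i Y) \<and> |carr (F i Y)| \<le>o \<mu>"
      by simp
    obtain Q where hull: "\<forall>i\<in>Field \<theta>. Q i = F i (\<Union>j\<in>underS \<theta> i. carr (Q j)) \<and>
        (\<Union>j\<in>underS \<theta> i. carr (Q j)) \<subseteq> carr (P i) \<and> |\<Union>j\<in>underS \<theta> i. carr (Q j)| \<le>o \<mu> \<and>
        leK (Q i) (P i) \<and> |carr (Q i)| \<le>o \<mu>"
      and Q_mono: "\<forall>i j. (i, j) \<in> \<theta> \<longrightarrow> leK (Q i) (Q j)"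
      using chain_of_small_models[OF P \<mu> \<theta>(2), where F = F, OF F_ext] by (elim exE conjE)
    have Q: "Q i = F i (\<Union>j\<in>underS \<theta> i. carr (Q j))"
        "(\<Union>j\<in>underS \<theta> i. carr (Q j)) \<subseteq> carr (P i)" "|\<Union>j\<in>underS \<theta> i. carr (Q j)| \<le>o \<mu>"
        "leK (Q i) (P i)" "|carr (Q i)| \<le>o \<mu>" if "i \<in> Field \<theta>" for i
      using bspec[OF hull that] by - (elim conjE, assumption)+
    have cover: "(A \<union> X) \<inter> carr (P i) \<subseteq> carr (Q i)" if "i \<in> Field \<theta>" for i
    proof -
      have "?Z i (\<Union>j\<in>underS \<theta> i. carr (Q j)) \<subseteq> carr (Q i)"
        unfolding Q(1)[OF that] using F[OF that Q(2,3)[OF that]] by (elim conjE)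
      then show ?thesis by (rule order_trans[OF Un_upper2])
    qed
    have "A \<union> X \<subseteq> (\<Union>i\<in>Field \<theta>. (A \<union> X) \<inter> carr (P i))" using A(1) X(1) by auto
    also have "\<dots> \<subseteq> chain_union \<theta> Q" by (rule UN_mono[OF order_refl cover])
    finally have "A \<union> X \<subseteq> chain_union \<theta> Q" .
    moreover have "is_chain (models leK N) leK \<theta> Q"
      using P Q(4) Q_mono P_N le_trans unfolding is_chain_def by blast
    moreover have "chain_union \<theta> Q \<subseteq> chain_union \<theta> P" using Q(4) le_carr by blast
    moreover have "|chain_union \<theta> Q| \<le>o \<mu>"
      by (rule UNION_Cinfinite_bound[OF \<theta>(2) _ \<mu>]) (use Q(5) in blast)
    ultimately show ?thesis by blast
  qed
  define B where "B X = (SOME Q. is_chain (models leK N) leK \<theta> Q \<and> A \<union> X \<subseteq> chain_union \<theta> Q \<and>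
      chain_union \<theta> Q \<subseteq> chain_union \<theta> P \<and> |chain_union \<theta> Q| \<le>o \<mu>)" for X
  have B: "is_chain (models leK N) leK \<theta> (B X) \<and> A \<union> X \<subseteq> chain_union \<theta> (B X) \<and>
      chain_union \<theta> (B X) \<subseteq> chain_union \<theta> P \<and> |chain_union \<theta> (B X)| \<le>o \<mu>"
    if "X \<subseteq> chain_union \<theta> P" "|X| \<le>o \<mu>" for X
    unfolding B_def by (rule someI_ex[OF chain_hull[OF that]])

  \<comment> \<open>Small models increasing inside \<open>P i0\<close>\<close>
  have model_hull: "\<exists>M'. leK M' ?M \<and> X \<subseteq> carr M' \<and> carr M0 \<subseteq> carr M' \<and> |carr M'| \<le>o \<mu> \<and>
      indep M' (chain_union \<theta> (B X)) (carr ?M)"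
    if X: "X \<subseteq> carr ?M" "|X| \<le>o \<mu>" for X
  proof -
    have BX: "chain_union \<theta> (B X) \<subseteq> carr N" "|chain_union \<theta> (B X)| \<le>o \<mu>"
      using B[of X] X i0(1) union_N by blast+
    \<comment> \<open>\<open>R\<close> is a small base for the hull of \<open>X\<close> against
      \<open>P i0\<close>. Enlarging it inside \<open>P i0\<close> by \<open>X\<close> and
      \<open>M0\<close> preserves this by base monotonicity.\<close>
    obtain R where R: "leK R ?M" "|carr R| \<le>o \<mu>" "indep R (chain_union \<theta> (B X)) (carr ?M)"
      using small_base[OF P_N[OF i0(1)] BX] by blast
    have "X \<union> carr M0 \<union> carr R \<subseteq> carr ?M" using X(1) le_carr[OF M0(1)] le_carr[OF R(1)] by blast
    moreover have "|X \<union> carr M0 \<union> carr R| \<le>o \<mu>"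
      by (intro Un_Cinfinite_bound X(2) M0(2) R(2) \<mu>)
    ultimately obtain M' where M': "leK M' ?M" "X \<union> carr M0 \<union> carr R \<subseteq> carr M'" "|carr M'| \<le>o \<mu>"
      using small_model[OF P_K[OF i0(1)]] by blast
    have "indep M' (chain_union \<theta> (B X)) (carr ?M)"
    proof (rule base_monotonicity[OF R(3)])
      show "M' \<in> models leK N" using M'(1) P_N[OF i0(1)] le_trans by blast
      show "leK R M'" using le_of_subset[OF R(1) M'(1)] M'(2) by blast
      show "carr M' \<subseteq> carr ?M \<union> carr R" using le_carr[OF M'(1)] by blast
    qed
    then show ?thesis using M' by blast
  qed
  define F where "F X = (SOME M'. leK M' ?M \<and> X \<subseteq> carr M' \<and> carr M0 \<subseteq> carr M' \<and> |carr M'| \<le>o \<mu> \<and>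
      indep M' (chain_union \<theta> (B X)) (carr ?M))" for X
  have F: "leK (F X) ?M \<and> X \<subseteq> carr (F X) \<and> carr M0 \<subseteq> carr (F X) \<and> |carr (F X)| \<le>o \<mu> \<and>
      indep (F X) (chain_union \<theta> (B X)) (carr ?M)"
    if "X \<subseteq> carr ?M" "|X| \<le>o \<mu>" for X
    unfolding F_def by (rule someI_ex[OF model_hull[OF that]])
  \<comment> \<open>The recursion runs along a constant chain, so that the one saturated set
    \<open>P i0\<close> contains the union of all \<open>S i\<close>.\<close>
  have const: "is_chain (models leK N) leK \<theta> (\<lambda>_. ?M)"
    using P P_N[OF i0(1)] le_refl[OF P_K[OF i0(1)]] unfolding is_chain_def by blast
  have F_ext: "\<forall>i\<in>Field \<theta>. \<forall>X. X \<subseteq> carr ?M \<and> |X| \<le>o \<mu> \<longrightarrow>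
      leK (F X) ?M \<and> X \<subseteq> carr (F X) \<and> |carr (F X)| \<le>o \<mu>"
    using F by simp
  obtain S where hull: "\<forall>i\<in>Field \<theta>. S i = F (\<Union>j\<in>underS \<theta> i. carr (S j)) \<and>
      (\<Union>j\<in>underS \<theta> i. carr (S j)) \<subseteq> carr ?M \<and> |\<Union>j\<in>underS \<theta> i. carr (S j)| \<le>o \<mu> \<and>
      leK (S i) ?M \<and> |carr (S i)| \<le>o \<mu>"
    and S_mono: "\<forall>i j. (i, j) \<in> \<theta> \<longrightarrow> leK (S i) (S j)"
    using chain_of_small_models[OF const \<mu> \<theta>(2), where F = "\<lambda>_. F", OF F_ext] by (elim exE conjE)
  have S: "S i = F (\<Union>j\<in>underS \<theta> i. carr (S j))"
      "(\<Union>j\<in>underS \<theta> i. carr (S j)) \<subseteq> carr ?M" "|\<Union>j\<in>underS \<theta> i. carr (S j)| \<le>o \<mu>"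
      "leK (S i) ?M" "|carr (S i)| \<le>o \<mu>" if "i \<in> Field \<theta>" for i
    using bspec[OF hull that] by - (elim conjE, assumption)+
  have S_chain: "is_chain (models leK N) leK \<theta> S"
    using P S(4) S_mono P_N[OF i0(1)] le_trans unfolding is_chain_def by blast
  have S_union: "chain_union \<theta> S \<subseteq> carr ?M" using S(4) le_carr by blast
  have "|chain_union \<theta> S| \<le>o \<mu>"
    by (rule UNION_Cinfinite_bound[OF \<theta>(2) _ \<mu>]) (use S(5) in blast)
  then obtain x where x: "x \<in> carr ?M"
    "gtp L K leK [x] (chain_union \<theta> S) N = gtp L K leK [c] (chain_union \<theta> S) N"
    using saturated[OF i0(1) S_union] by blast
  have x_N: "x \<in> carr N" using x(1) le_carr[OF P_N[OF i0(1)]] by blast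

  \<comment> \<open>Transfer of the type to a hull of \<open>A\<close>\<close>
  obtain i where i: "i \<in> Field \<theta>" "indep (S i) {x} (chain_union \<theta> S)"
    using chain_local[OF S_chain, of "{x}"] x_N singleton(1) by blast
  \<comment> \<open>The index is strictly above \<open>i\<close>, so that \<open>S i\<close> is
    contained in the set \<open>X\<close> from which \<open>S j\<close> was formed, and hence in
    \<open>B X\<close>.\<close>
  obtain j where j: "j \<in> Field \<theta>" "i \<noteq> j" "(i, j) \<in> \<theta>"
    using infinite_Card_order_limit[of \<theta> i] \<theta>(1) i(1) unfolding cinfinite_def by blast
  have S_N: "leK (S l) N" if "l \<in> Field \<theta>" for l using le_trans[OF S(4)[OF that] P_N[OF i0(1)]] .
  define X where "X = (\<Union>l\<in>underS \<theta> j. carr (S l))"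
  have X: "X \<subseteq> carr ?M" "|X| \<le>o \<mu>" unfolding X_def using S(2,3)[OF j(1)] by blast+
  have Si_X: "carr (S i) \<subseteq> X" unfolding X_def using j(2,3) unfolding underS_def by blast
  let ?B = "chain_union \<theta> (B X)"
  have BX: "is_chain (models leK N) leK \<theta> (B X)" "A \<union> X \<subseteq> ?B" "?B \<subseteq> chain_union \<theta> P"
    using B[of X] X i0(1) by blast+
  \<comment> \<open>\<open>S j\<close> was chosen as a base for exactly this hull. Since
    \<open>x\<close> lies in \<open>P i0\<close>, symmetry makes \<open>x\<close> independent from
    the hull over \<open>S j\<close>.\<close>
  have "indep (S j) ?B (carr ?M)" using F[OF X] unfolding S(1)[OF j(1), folded X_def] by blast
  then have "indep (S j) ?B {x}" by (rule monotonicity[OF _ order_refl]) (use x(1) in blast)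
  then have "indep (S j) {x} ?B" by (rule symmetry)
  moreover have "indep (S i) {x} (carr (S j))"
    by (rule monotonicity[OF i(2) order_refl]) (use j(1) in blast)
  ultimately have x_B: "indep (S i) {x} ?B"
    using strong_transitivity[of "S i" "S j"] S_N[OF i(1)] S_N[OF j(1)] by blast
  have M0_Si: "carr M0 \<subseteq> carr (S i)" using F[OF S(2,3)[OF i(1)]] unfolding S(1)[OF i(1), symmetric] by blast
  \<comment> \<open>The base for \<open>c\<close> moves up from \<open>M0\<close> to
    \<open>S i\<close>, which lies in \<open>P i0\<close> and so in the union.\<close>
  have "indep (S i) {c} (chain_union \<theta> P)"
  proof (rule base_monotonicity[OF c_M0])
    show "S i \<in> models leK N" using S_N[OF i(1)] by blast
    show "leK M0 (S i)" by (rule le_of_subset[OF M0(1) S(4)[OF i(1)] M0_Si])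
    show "carr (S i) \<subseteq> chain_union \<theta> P \<union> carr M0" using le_carr[OF S(4)[OF i(1)]] i0(1) by blast
  qed
  then have c_B: "indep (S i) {c} ?B" by (rule monotonicity[OF _ order_refl BX(3)])
  have "gtp L K leK [x] (carr (S i)) N = gtp L K leK [c] (carr (S i)) N"
    by (rule gtp_mono[OF x(2) _ N_in_class]) (use i(1) S_union x_N c le_carr[OF P_N[OF i0(1)]] in auto)
  moreover have B_N: "?B \<subseteq> carr N" using BX(3) union_N by blast
  \<comment> \<open>\<open>N\<close> itself serves as the ambient model in the uniqueness
    axiom.\<close>
  ultimately have "gtp L K leK [x] ?B N = gtp L K leK [c] ?B N"
    using uniqueness[of "S i" N \<theta> "B X" ?B "[x]" "[c]"] S_N[OF i(1)] le_refl[OF N_in_class]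
      BX(1,2) Si_X x_B c_B x_N c by auto
  then have "gtp L K leK [x] A N = gtp L K leK [c] A N"
    by (rule gtp_mono[OF _ _ N_in_class B_N]) (use BX(2) x_N c in auto)
  then show ?thesis using x(1) i0(1) by blast
qed

theorem theorem3p14:
  fixes L :: "('f, 'r, 'p) lang"
    and K :: "('f, 'r, 'p, 'u) struct set"
    and leK :: "('f, 'r, 'p, 'u) struct \<Rightarrow> ('f, 'r, 'p, 'u) struct \<Rightarrow> bool"
    and N :: "('f, 'r, 'p, 'u) struct"
    and indep :: "('f, 'r, 'p, 'u) struct \<Rightarrow> 'u set \<Rightarrow> 'u set \<Rightarrow> bool"
    and \<kappa> :: "'k rel" and lam0 :: "'l rel" and ls :: "'s rel" and lam :: "'c rel"
    and \<delta> :: "'d rel" and M :: "'d \<Rightarrow> ('f, 'r, 'p, 'u) struct"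
    and \<kappa>bar1 :: "'u set rel"
  assumes "independence_setting L K leK \<kappa> lam0 N indep"
    and "kappa_AEC L K leK \<kappa> ls"
    and "Card_order lam" and "ls <o lam"
    and "is_chain (models leK N) leK \<delta> M"
    and "\<And>i. i \<in> Field \<delta> \<Longrightarrow> saturated_length_one L K leK N lam (carr (M i))"
    and "is_chain_local_card leK N indep cone \<kappa>bar1" and "\<kappa>bar1 \<le>o cofinality \<delta>"
    and "\<And>\<chi> :: 'c rel. Card_order \<chi> \<Longrightarrow> \<chi> <o lam \<Longrightarrow> cexp_less \<chi> (regular_above \<kappa>) <o lam"
  shows "saturated_length_one L K leK N lam (chain_union \<delta> M)"
proof -
  interpret independence_setting L K leK \<kappa> lam0 N indep by fact
  interpret AEC: kappa_AEC L K leK \<kappa> ls by fact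
  have wo: "Well_order \<delta>" and M_N: "\<And>i. i \<in> Field \<delta> \<Longrightarrow> leK (M i) N"
    and M_mono: "\<And>i j. (i, j) \<in> \<delta> \<Longrightarrow> leK (M i) (M j)"
    using assms(5) unfolding is_chain_def by auto
  have M_sat: "\<exists>x\<in>carr (M i). gtp L K leK [x] Y N = gtp L K leK [c] Y N"
    if "i \<in> Field \<delta>" "Y \<subseteq> carr (M i)" "|Y| <o lam" "c \<in> carr N" for i Y c
  proof -
    have "\<forall>Y c. Y \<subseteq> carr (M i) \<longrightarrow> |Y| <o lam \<longrightarrow> c \<in> carr N \<longrightarrow>
        (\<exists>x\<in>carr (M i). gtp L K leK [x] Y N = gtp L K leK [c] Y N)"
      using assms(6)[OF that(1)] unfolding saturated_length_one_def by (rule conjunct2)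
    then show ?thesis using that(2-4) by blast
  qed
  have "\<exists>x\<in>chain_union \<delta> M. gtp L K leK [x] A N = gtp L K leK [c] A N"
    if A: "A \<subseteq> chain_union \<delta> M" "|A| <o lam" and c: "c \<in> carr N" for A c
  proof (cases "\<exists>i\<in>Field \<delta>. A \<subseteq> carr (M i)")
    case True
    then obtain i where i: "i \<in> Field \<delta>" "A \<subseteq> carr (M i)" by (rule bexE)
    obtain x where "x \<in> carr (M i)" "gtp L K leK [x] A N = gtp L K leK [c] A N"
      using M_sat[OF i A(2) c] by (rule bexE)
    then show ?thesis using i(1) by (intro bexI[of _ x] UN_I)
  next
    case False
    let ?\<rho> = "regular_above \<kappa>"
    have \<rho>: "Cinfinite ?\<rho>" "regularCard ?\<rho>" "\<kappa> \<le>o ?\<rho>"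
      using regular_above_least_card[OF kappa_infinite] unfolding least_card_def by auto

    \<comment> \<open>The size bound \<open>\<mu>\<close>\<close>
    have ls: "Cinfinite ls"
    proof (rule ccontr)
      assume "\<not> Cinfinite ls"
      then have fin: "Cfinite ls" using AEC.ls_card unfolding cfinite_def cinfinite_def by simp
      \<comment> \<open>A model obtained over the empty set has size at most 1 + \<open>ls\<close>,
        but at least the infinite \<open>lam0\<close>.\<close>
      obtain M0 where M0: "leK M0 N" "|carr M0| \<le>o cexp_less |{} :: 'u set| \<kappa> +c ls"
        using AEC.lowenheim_skolem[OF N_in_class empty_subsetI] by blast
      have "lam0 \<le>o |carr M0|" using size_ge le_in_class M0(1) by blast
      also note M0(2)
      also have "cexp_less |{} :: 'u set| \<kappa> +c ls \<le>o cone +c ls" by (rule csum_mono1[OF cexp_less_empty])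
      finally have "cinfinite (cone +c ls)" using cinfinite_mono lam0_infinite by blast
      moreover have "Cfinite (cone +c ls)" by (rule Cfinite_csum[OF Cfinite_cone fin])
      ultimately show False unfolding cfinite_def cinfinite_def by simp
    qed
    have lam: "Cinfinite lam" using cinfinite_mono[OF ordLess_imp_ordLeq[OF assms(4)]] ls assms(3) by simp
    have "|A| +c ls <o lam"
      unfolding csum_def Field_card_of
      using card_of_Plus_ordLess_infinite_Field[OF _ assms(3) A(2) ordLess_Field[OF assms(4)]] lam
      unfolding cinfinite_def by simp
    \<comment> \<open>The cardinal is copied to the type of \<open>lam\<close>, where the hypothesis
      on powers applies.\<close>
    then obtain X where X: "|X :: 'c set| =o |A| +c ls" "|A| +c ls <o lam"
      using Card_order_ordLeq_obtain[OF Card_order_csum ordLess_imp_ordLeq] by metis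
    let ?\<chi> = "|X|"
    have A_\<chi>: "|A| \<le>o ?\<chi>"
      by (rule ordLeq_ordIso_trans[OF ordLeq_csum1[OF card_of_Card_order] ordIso_symmetric[OF X(1)]])
    have ls_\<chi>: "ls \<le>o ?\<chi>"
      by (rule ordLeq_ordIso_trans[OF ordLeq_csum2[OF AEC.ls_card] ordIso_symmetric[OF X(1)]])
    have \<chi>: "Cinfinite ?\<chi>" using cinfinite_mono[OF ls_\<chi>] ls card_of_Card_order by simp
    \<comment> \<open>This value is still below \<open>lam\<close> and absorbs both the
      Loewenheim-Skolem bound and the local character bound.\<close>
    define \<mu> where "\<mu> = cexp_less ?\<chi> ?\<rho>"
    have \<mu>_lam: "\<mu> <o lam"
      unfolding \<mu>_def by (rule assms(9)[OF card_of_Card_order ordIso_ordLess_trans[OF X]])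
    have \<chi>_\<mu>: "?\<chi> \<le>o \<mu>" unfolding \<mu>_def by (rule ordLeq_cexp_less[OF \<rho>(1) card_of_Card_order])
    have \<mu>: "Cinfinite \<mu>"
      using cinfinite_mono[OF \<chi>_\<mu>] \<chi> Card_order_cexp_less unfolding \<mu>_def by blast
    have A_\<mu>: "|A| \<le>o \<mu>" by (rule ordLeq_transitive[OF A_\<chi> \<chi>_\<mu>])

    \<comment> \<open>Small models and small bases\<close>
    have small_model: "\<exists>M0. leK M0 M' \<and> Y \<subseteq> carr M0 \<and> |carr M0| \<le>o \<mu>"
      if Y: "M' \<in> K" "Y \<subseteq> carr M'" "|Y| \<le>o \<mu>" for M' Y
    proof -
      obtain M0 where M0: "leK M0 M'" "Y \<subseteq> carr M0" "|carr M0| \<le>o cexp_less |Y| \<kappa> +c ls"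
        using AEC.lowenheim_skolem[OF Y(1,2)] by blast
      have "cexp_less |Y| \<kappa> \<le>o \<mu>"
        unfolding \<mu>_def
        by (rule cexp_less_cexp_less_ordLeq[OF \<rho>(1,2) \<chi> \<rho>(3) Y(3)[unfolded \<mu>_def]])
      then have "cexp_less |Y| \<kappa> +c ls \<le>o \<mu>"
        by (rule csum_cinfinite_bound[OF _ ordLeq_transitive[OF ls_\<chi> \<chi>_\<mu>] Card_order_cexp_less AEC.ls_card \<mu>])
      then show ?thesis using M0 ordLeq_transitive[OF M0(3)] by blast
    qed
    have lam0_\<mu>: "lam0 \<le>o \<mu>"
    proof -
      \<comment> \<open>All models have size at least \<open>lam0\<close>, so one model of size at
        most \<open>\<mu>\<close> suffices.\<close>
      obtain M0 where "leK M0 N" "|carr M0| \<le>o \<mu>"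
        using small_model[OF N_in_class empty_subsetI card_of_empty1] \<mu> by auto
      then show ?thesis using ordLeq_transitive[OF size_ge] le_in_class by blast
    qed
    have small_base: "\<exists>M0. leK M0 M' \<and> |carr M0| \<le>o \<mu> \<and> indep M0 Y (carr M')"
      if Y: "leK M' N" "Y \<subseteq> carr N" "|Y| \<le>o \<mu>" for M' Y
    proof -
      let ?S = "cexp_less ( |Y| +c lam0) ?\<rho>"
      obtain \<mu>' where \<mu>': "is_local_card leK N indep lam0 |Y| \<mu>'" "\<mu>' \<le>o cardSuc ?S"
        using local_character[OF card_of_Card_order] by blast
      have "|Y| \<le>o |Y|" by (rule card_of_mono1[OF order_refl])
      then obtain M0 where M0: "leK M0 M'" "|carr M0| <o \<mu>'" "indep M0 Y (carr M')"
        using \<mu>'(1) Y(1,2) unfolding is_local_card_def least_card_def by blast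
      have "|carr M0| \<le>o ?S"
        using ordLess_ordLeq_trans[OF M0(2) \<mu>'(2)]
          cardSuc_ordLeq_ordLess[OF Card_order_cexp_less card_of_Card_order] by blast
      moreover have "|Y| +c lam0 \<le>o \<mu>"
        by (rule csum_cinfinite_bound[OF Y(3) lam0_\<mu> card_of_Card_order conjunct2[OF lam0_infinite] \<mu>])
      then have "?S \<le>o \<mu>"
        unfolding \<mu>_def
        by (intro cexp_less_cexp_less_ordLeq[OF \<rho>(1,2) \<chi>] ordLeq_refl) (use \<rho>(1) in auto)
      ultimately show ?thesis using M0 ordLeq_transitive by blast
    qed

    \<comment> \<open>Passage to a regular index\<close>
    have cof_A: "cofinality \<delta> \<le>o |A|"
      by (rule cofinality_ordLeq_of_cover[OF wo le_carr[OF M_mono] A(1)]) (use False in auto)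
    have cof_card: "Card_order (cofinality \<delta>)"
      using cofinality_properties(1)[OF wo] card_of_Card_order by metis
    obtain Z where Z: "|Z :: 'u set| =o cofinality \<delta>"
      by (rule Card_order_ordLeq_obtain[OF cof_card cof_A])
    \<comment> \<open>Chain local character is stated for cardinals on \<open>'u set\<close>. The
      bound \<open>|A|\<close> places the cofinality on \<open>'u\<close>, and singletons carry it
      to \<open>'u set\<close>.\<close>
    define \<theta> where "\<theta> = |(\<lambda>z :: 'u. {z}) ` Z|"
    have "bij_betw (\<lambda>z :: 'u. {z}) Z ((\<lambda>z. {z}) ` Z)" by (simp add: bij_betw_def inj_on_def)
    then have \<theta>_cof: "\<theta> =o cofinality \<delta>"
      unfolding \<theta>_def using ordIso_transitive[OF ordIso_symmetric Z] card_of_ordIso by blast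
    have bar: "Card_order \<kappa>bar1" "cardSuc cone +c natLeq \<le>o \<kappa>bar1"
      "\<And>(\<delta> :: 'u set rel) M Y. Card_order \<delta> \<Longrightarrow> regularCard \<delta> \<Longrightarrow> \<kappa>bar1 \<le>o \<delta> \<Longrightarrow>
        is_chain (models leK N) leK \<delta> M \<Longrightarrow> Y \<subseteq> carr N \<Longrightarrow> |Y| \<le>o cone \<Longrightarrow>
        \<exists>i\<in>Field \<delta>. indep (M i) Y (chain_union \<delta> M)"
      using assms(7) unfolding is_chain_local_card_def least_card_def by auto
    have bar_\<theta>: "\<kappa>bar1 \<le>o \<theta>" by (rule ordLeq_ordIso_trans[OF assms(8) ordIso_symmetric[OF \<theta>_cof]])
    have "cinfinite \<theta>"
      by (rule cinfinite_mono[OF ordLeq_transitive[OF bar(2) bar_\<theta>]]) (simp add: cinfinite_csum natLeq_cinfinite)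
    then have \<theta>: "Cinfinite \<theta>" unfolding \<theta>_def using card_of_Card_order by simp
    obtain h where h: "regularCard \<theta>" "\<And>i. i \<in> Field \<theta> \<Longrightarrow> h i \<in> Field \<delta>"
      "\<And>i j. (i, j) \<in> \<theta> \<Longrightarrow> (h i, h j) \<in> \<delta>"
      "\<And>a. a \<in> Field \<delta> \<Longrightarrow> \<exists>i\<in>Field \<theta>. (a, h i) \<in> \<delta>"
      by (rule cofinal_reindexing[OF wo \<theta> \<theta>_cof]) (rule that)
    \<comment> \<open>Passing to a cofinal subsequence leaves the union unchanged, so the type may
      be realized there.\<close>
    have union_eq: "chain_union \<theta> (\<lambda>i. M (h i)) = chain_union \<delta> M"
    proof
      show "chain_union \<theta> (\<lambda>i. M (h i)) \<subseteq> chain_union \<delta> M" using h(2) by blast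
      show "chain_union \<delta> M \<subseteq> chain_union \<theta> (\<lambda>i. M (h i))"
      proof
        fix x assume "x \<in> chain_union \<delta> M"
        then obtain a where a: "a \<in> Field \<delta>" "x \<in> carr (M a)" by blast
        obtain i where i: "i \<in> Field \<theta>" "(a, h i) \<in> \<delta>" using h(4)[OF a(1)] by blast
        then show "x \<in> chain_union \<theta> (\<lambda>i. M (h i))" using le_carr[OF M_mono[OF i(2)]] a(2) by blast
      qed
    qed
    have "|Field \<theta>| \<le>o \<mu>"
    proof -
      have "|Field \<theta>| =o \<theta>" using card_of_Field_ordIso \<theta> by blast
      also note \<theta>_cof
      also note cof_A
      also note A_\<mu>
      finally show ?thesis .
    qed
    moreover have "is_chain (models leK N) leK \<theta> (\<lambda>i. M (h i))"
      using \<theta> card_order_on_well_order_on M_N[OF h(2)] M_mono[OF h(3)] unfolding is_chain_def by blast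
    moreover have "\<exists>x\<in>carr (M (h i)). gtp L K leK [x] Y N = gtp L K leK [c] Y N"
      if "i \<in> Field \<theta>" "Y \<subseteq> carr (M (h i))" "|Y| \<le>o \<mu>" for i Y
      using M_sat[OF h(2)[OF that(1)] that(2) ordLeq_ordLess_trans[OF that(3) \<mu>_lam] c] .
    moreover have "A \<subseteq> chain_union \<theta> (\<lambda>i. M (h i))" using A(1) union_eq by simp
    ultimately have "\<exists>x\<in>chain_union \<theta> (\<lambda>i. M (h i)). gtp L K leK [x] A N = gtp L K leK [c] A N"
      by (intro type_realized_in_union[OF small_model small_base \<mu> \<theta> _ bar(3)[OF conjunct2[OF \<theta>] h(1) bar_\<theta>]])
        (use A_\<mu> c in auto)
    then show ?thesis unfolding union_eq .
  qed
  moreover have "chain_union \<delta> M \<subseteq> carr N" using M_N le_carr by blast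
  ultimately show ?thesis unfolding saturated_length_one_def by simp
qed

end
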